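(* Let $\delta>1/2$, $H=H(\delta)$, $f_0\in L^2$, and let $\Pi$ be a prior on $L^2$ satisfying the weak Bernstein--von Mises phenomenon in $H$ at $f_0$, i.e. $\beta(\Pi_n\circ\tau_{\mathbb X^{(n)}}^{-1},\mathcal N)\to0$ in $P_{f_0}^n$-probability. Let $\Psi:L^2\to\mathbb R$ be a functional satisfying $$\Psi(f_0+h)-\Psi(f_0)=D\Psi_{f_0}[h]+O(\|h\|_2^2)$$ uniformly in $h\in L^2$, for some linear continuous $D\Psi_{f_0}:L^2\to\mathbb R$ that has a nonzero $L^2$-Riesz representer $\dot\Psi_{f_0}\in H^s_2$ for some $s>1/2$. Assume moreover either that $\Psi$ is linear, or that for some sequence $r_n=o(n^{-1/2})$, $$\Pi_n(f:\|f-f_0\|_2^2>r_n)=o_P(1).$$ Let $0<\alpha<1$, let $\Pi_n^\Psi=\Pi_n\circ\Psi^{-1}$, and let $\mu_n,\nu_n$ satisfy $$\Pi_n^\Psi((-\infty,\mu_n])=\Pi_n^\Psi((\nu_n,+\infty))=\frac\alpha2.$$ Then, as $n\to\infty$, $$P_{f_0}^n\big(\Psi(f_0)\in(\mu_n,\nu_n]\big)\to1-\alpha.$$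
   Context: Basis. $L^2=L^2([0,1])$, $\langle f,g\rangle=\int_0^1 f\bar g$. Fix an $S$-regular ($S\in\mathbb N$, $S>s$) orthonormal basis $\{\psi_{lk}: l\in\mathcal L,k\in\mathcal Z_l\}$ of $L^2$ ($\mathcal L,\mathcal Z_l\subset\mathbb Z$) with characteristic sequence $a_l$, meaning that every $\psi_{lk}$ is $S$-times differentiable with all derivatives in $L^2$ and either (a) $|\mathcal Z_l|=1$ and $a_l=\max(2,|l|)$, or (b) $\mathcal L\subset\mathbb N=\{1,2,\dots\}$ and $a_l=|\mathcal Z_l|=2^l$. For $0\le s<S$, $H^s_2=\{f\in L^2:\|f\|_{s,2}^2=\sum_l a_l^{2s}\sum_k|\langle\psi_{lk},f\rangle|^2<\infty\}$. Space $H$. For $\delta>1/2$, $H(\delta)$ is the Hilbert space of linear forms $f$ on $\mathrm{span}\{\psi_{lk}\}$ (identified with their coefficients $\langle f,\psi_{lk}\rangle$) with $\|f\|_{H(\delta)}^2=\sum_{l}a_l^{-1}(\log a_l)^{-2\delta}\sum_{k}|\langle f,\psi_{lk}\rangle|^2<\infty$. It contains $L^2$. Standard white noise $\mathbb W$, with i.i.d. $N(0,1)$ coefficients in the basis, is a tight centered Gaussian Borel random variable in $H(\delta)$; its law is $\mathcal N$. Model. For $f\in L^2$, $P_f^n$ is the law of $\mathbb X^{(n)}=f+n^{-1/2}\mathbb W$ in $H(\delta)$. A prior $\Pi$ is a Borel probability measure on $L^2$; the posterior $\Pi_n=\Pi(\cdot\mid\mathbb X^{(n)})$ is the conditional law of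 $f$ given $\mathbb X^{(n)}$ when $f\sim\Pi$, $\mathbb X^{(n)}\mid f\sim P_f^n$ (Bayes' formula with likelihood $dP_f^n/dP_0^n=\exp(n\langle f,\mathbb X^{(n)}\rangle-\tfrac n2\|f\|_2^2)$), also viewed as a measure on $H(\delta)$. $\Psi$ is understood to be measurable, so that $\Pi_n\circ\Psi^{-1}$ makes sense. The posterior is studied when $\mathbb X^{(n)}\sim P_{f_0}^n$; $o_P$ refers to $P_{f_0}^n$. Weak Bernstein--von Mises phenomenon. $\tau_z(f)=\sqrt n(f-z)$ on $H$; $\beta$ is the bounded Lipschitz metric on Borel probability measures on $H$, $\beta(\mu,\nu)=\sup_u|\int u\,d(\mu-\nu)|$ over $u:H\to\mathbb R$ with $\sup|u|+\mathrm{Lip}(u)\le1$. *)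

theory Defs
  imports "HOL-Probability.Probability" "HOL-Library.Landau_Symbols"
begin

section \<open>The Hilbert space of square integrable real functions on the unit interval\<close>

definition sq_int :: "(real \<Rightarrow> real) \<Rightarrow> bool" where
  "sq_int f \<longleftrightarrow> f \<in> borel_measurable (lebesgue_on {0..1}) \<and>
     integrable (lebesgue_on {0..1}) (\<lambda>x. (f x)\<^sup>2)"

definition l2_rel :: "(real \<Rightarrow> real) \<Rightarrow> (real \<Rightarrow> real) \<Rightarrow> bool" where
  "l2_rel f g \<longleftrightarrow> sq_int f \<and> sq_int g \<and> (AE x in lebesgue_on {0..1}. f x = g x)"

lemma sq_int_zero: "sq_int (\<lambda>_. 0)"
  by (simp add: sq_int_def)

lemma sq_int_mult:
  assumes "sq_int f" "sq_int g"
  shows "integrable (lebesgue_on {0..1}) (\<lambda>x. f x * g x)"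
proof (rule Bochner_Integration.integrable_bound[where f = "\<lambda>x. (f x)\<^sup>2 + (g x)\<^sup>2"])
  show "integrable (lebesgue_on {0..1}) (\<lambda>x. (f x)\<^sup>2 + (g x)\<^sup>2)"
    using assms by (simp add: sq_int_def)
  show "(\<lambda>x. f x * g x) \<in> borel_measurable (lebesgue_on {0..1})"
    using assms by (auto simp: sq_int_def intro: borel_measurable_times)
  have "\<bar>a * b\<bar> \<le> a\<^sup>2 + b\<^sup>2" for a b :: real
  proof -
    have "2 * (\<bar>a\<bar> * \<bar>b\<bar>) \<le> a\<^sup>2 + b\<^sup>2"
      using sum_squares_bound[of "\<bar>a\<bar>" "\<bar>b\<bar>"] by simp
    moreover have "0 \<le> \<bar>a\<bar> * \<bar>b\<bar>" by simp
    ultimately show ?thesis unfolding abs_mult by linarith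
  qed
  then show "AE x in lebesgue_on {0..1}. norm (f x * g x) \<le> norm ((f x)\<^sup>2 + (g x)\<^sup>2)"
    by simp
qed

lemma sq_int_add:
  assumes "sq_int f" "sq_int g"
  shows "sq_int (\<lambda>x. f x + g x)"
proof -
  have "integrable (lebesgue_on {0..1}) (\<lambda>x. (f x)\<^sup>2 + (g x)\<^sup>2 + 2 * (f x * g x))"
    using assms sq_int_mult[OF assms] by (simp add: sq_int_def)
  then show ?thesis
    using assms by (auto simp: sq_int_def power2_sum mult.assoc intro: borel_measurable_add)
qed

lemma sq_int_scale: "sq_int f \<Longrightarrow> sq_int (\<lambda>x. c * f x)"
  by (auto simp: sq_int_def power_mult_distrib intro: borel_measurable_times)

lemma sq_int_uminus: "sq_int f \<Longrightarrow> sq_int (\<lambda>x. - f x)"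
  by (auto simp: sq_int_def intro: borel_measurable_uminus)

lemma sq_int_diff: "sq_int f \<Longrightarrow> sq_int g \<Longrightarrow> sq_int (\<lambda>x. f x - g x)"
  using sq_int_add[of f "\<lambda>x. - g x"] sq_int_uminus[of g] by simp

quotient_type L2 = "real \<Rightarrow> real" / partial: l2_rel
proof (rule part_equivpI)
  show "\<exists>f. l2_rel f f"
    using sq_int_zero by (auto simp: l2_rel_def intro!: exI[of _ "\<lambda>_. 0"])
  show "symp l2_rel"
    by (auto simp: symp_def l2_rel_def elim: AE_mp)
  show "transp l2_rel"
    unfolding transp_def l2_rel_def by (auto elim: AE_mp)
qed

instantiation L2 :: real_inner
begin

lift_definition zero_L2 :: L2 is "\<lambda>_. 0"
  by (simp add: l2_rel_def sq_int_zero)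

lift_definition plus_L2 :: "L2 \<Rightarrow> L2 \<Rightarrow> L2" is "\<lambda>f g x. f x + g x"
  unfolding l2_rel_def by (auto intro: sq_int_add)

lift_definition uminus_L2 :: "L2 \<Rightarrow> L2" is "\<lambda>f x. - f x"
  unfolding l2_rel_def by (auto intro: sq_int_uminus)

lift_definition minus_L2 :: "L2 \<Rightarrow> L2 \<Rightarrow> L2" is "\<lambda>f g x. f x - g x"
  unfolding l2_rel_def by (auto intro: sq_int_diff)

lift_definition scaleR_L2 :: "real \<Rightarrow> L2 \<Rightarrow> L2" is "\<lambda>c f x. c * f x"
  unfolding l2_rel_def by (auto intro: sq_int_scale)

lift_definition inner_L2 :: "L2 \<Rightarrow> L2 \<Rightarrow> real"
  is "\<lambda>f g. \<integral>x. f x * g x \<partial>lebesgue_on {0..1}"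
proof -
  fix f f' g g' :: "real \<Rightarrow> real"
  assume *: "l2_rel f f'" "l2_rel g g'"
  show "(\<integral>x. f x * g x \<partial>lebesgue_on {0..1}) = (\<integral>x. f' x * g' x \<partial>lebesgue_on {0..1})"
  proof (rule integral_cong_AE)
    show "(\<lambda>x. f x * g x) \<in> borel_measurable (lebesgue_on {0..1})"
      and "(\<lambda>x. f' x * g' x) \<in> borel_measurable (lebesgue_on {0..1})"
      using * by (auto simp: l2_rel_def sq_int_def intro: borel_measurable_times)
    show "AE x in lebesgue_on {0..1}. f x * g x = f' x * g' x"
      using * by (auto simp: l2_rel_def)
  qed
qed

definition norm_L2 :: "L2 \<Rightarrow> real" where
  "norm_L2 f = sqrt (inner f f)"

definition dist_L2 :: "L2 \<Rightarrow> L2 \<Rightarrow> real" where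
  "dist_L2 f g = norm (f - g)"

definition sgn_L2 :: "L2 \<Rightarrow> L2" where
  "sgn_L2 f = inverse (norm f) *\<^sub>R f"

definition uniformity_L2 :: "(L2 \<times> L2) filter" where
  "uniformity_L2 = (INF e\<in>{0<..}. principal {(f, g). dist f g < e})"

definition open_L2 :: "L2 set \<Rightarrow> bool" where
  "open_L2 U \<longleftrightarrow> (\<forall>f\<in>U. eventually (\<lambda>(f', g). f' = f \<longrightarrow> g \<in> U) uniformity)"

instance
proof
  fix f g h :: L2 and c d :: real
  show "f + g + h = f + (g + h)"
    by transfer (auto simp: l2_rel_def add.assoc intro!: sq_int_add)
  show "f + g = g + f"
    by transfer (auto simp: l2_rel_def add.commute intro!: sq_int_add)
  show "0 + f = f"
    by transfer (auto simp: l2_rel_def)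
  show "- f + f = 0"
    by transfer (auto simp: l2_rel_def sq_int_zero)
  show "f - g = f + - g"
    by transfer (auto simp: l2_rel_def intro!: sq_int_diff)
  show "c *\<^sub>R (f + g) = c *\<^sub>R f + c *\<^sub>R g"
    using sq_int_add sq_int_scale
    by transfer (auto simp: l2_rel_def distrib_left)
  show "(c + d) *\<^sub>R f = c *\<^sub>R f + d *\<^sub>R f"
    by transfer (auto simp: l2_rel_def distrib_right intro!: sq_int_add sq_int_scale)
  show "c *\<^sub>R d *\<^sub>R f = (c * d) *\<^sub>R f"
    by transfer (auto simp: l2_rel_def mult.assoc intro!: sq_int_scale)
  show "1 *\<^sub>R f = f"
    by transfer (auto simp: l2_rel_def)
  show "dist f g = norm (f - g)"
    by (simp add: dist_L2_def)
  show "sgn f = inverse (norm f) *\<^sub>R f"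
    by (simp add: sgn_L2_def)
  show "uniformity = (INF e\<in>{0<..}. principal {(f, g :: L2). dist f g < e})"
    by (simp add: uniformity_L2_def)
  show "open U \<longleftrightarrow> (\<forall>f\<in>U. eventually (\<lambda>(f', g). f' = f \<longrightarrow> g \<in> U) uniformity)" for U :: "L2 set"
    by (simp add: open_L2_def)
  show "inner f g = inner g f"
    by transfer (simp add: mult.commute)
  show "inner (f + g) h = inner f h + inner g h"
    by transfer (auto simp: l2_rel_def distrib_right sq_int_mult)
  show "inner (c *\<^sub>R f) g = c * inner f g"
    by transfer (simp add: mult.assoc)
  show "0 \<le> inner f f"
    by transfer simp
  show "inner f f = 0 \<longleftrightarrow> f = 0"
  proof transfer
    fix f :: "real \<Rightarrow> real"
    assume "l2_rel f f"
    then have f: "sq_int f" by (simp add: l2_rel_def)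
    have "(\<integral>x. f x * f x \<partial>lebesgue_on {0..1}) = 0 \<longleftrightarrow>
        (AE x in lebesgue_on {0..1}. f x * f x = 0)"
      by (rule integral_nonneg_eq_0_iff_AE) (use sq_int_mult[OF f f] in auto)
    then show "(\<integral>x. f x * f x \<partial>lebesgue_on {0..1}) = 0 \<longleftrightarrow> l2_rel f (\<lambda>_. 0)"
      using f by (simp add: l2_rel_def sq_int_zero)
  qed
  show "norm f = sqrt (inner f f)"
    by (simp add: norm_L2_def)
qed

end


section \<open>Regular bases and Sobolev spaces\<close>

text \<open>The elements of \<open>L2\<close> are classes of functions; a class is \<open>S\<close> times differentiable if it has
  a representative with this property on \<open>[0,1]\<close> (one-sided at the endpoints).\<close>

definition regular_L2 :: "nat \<Rightarrow> L2 \<Rightarrow> bool" where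
  "regular_L2 S f \<longleftrightarrow> (\<exists>G :: nat \<Rightarrow> real \<Rightarrow> real.
     (\<forall>j\<le>S. sq_int (G j)) \<and> f = abs_L2 (G 0) \<and>
     (\<forall>j<S. \<forall>x\<in>{0..1}. (G j has_real_derivative G (Suc j) x) (at x within {0..1})))"

definition orthonormal_basis :: "int set \<Rightarrow> (int \<Rightarrow> int set) \<Rightarrow> (int \<Rightarrow> int \<Rightarrow> L2) \<Rightarrow> bool" where
  "orthonormal_basis L Z \<psi> \<longleftrightarrow>
     (\<forall>(l, k)\<in>Sigma L Z. \<forall>(l', k')\<in>Sigma L Z.
        inner (\<psi> l k) (\<psi> l' k') = (if (l, k) = (l', k') then 1 else 0)) \<and>
     closure (span {\<psi> l k | l k. (l, k) \<in> Sigma L Z}) = UNIV"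

definition regular_basis ::
  "nat \<Rightarrow> int set \<Rightarrow> (int \<Rightarrow> int set) \<Rightarrow> (int \<Rightarrow> real) \<Rightarrow> (int \<Rightarrow> int \<Rightarrow> L2) \<Rightarrow> bool" where
  "regular_basis S L Z a \<psi> \<longleftrightarrow>
     orthonormal_basis L Z \<psi> \<and>
     (\<forall>(l, k)\<in>Sigma L Z. regular_L2 S (\<psi> l k)) \<and>
     ((\<forall>l\<in>L. card (Z l) = 1 \<and> a l = max 2 \<bar>real_of_int l\<bar>) \<or>
      (\<forall>l\<in>L. l \<ge> 1 \<and> a l = 2 ^ nat l \<and> real (card (Z l)) = a l))"

definition sobolev ::
  "int set \<Rightarrow> (int \<Rightarrow> int set) \<Rightarrow> (int \<Rightarrow> real) \<Rightarrow> (int \<Rightarrow> int \<Rightarrow> L2) \<Rightarrow> real \<Rightarrow> L2 set" where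
  "sobolev L Z a \<psi> s =
     {f. (\<lambda>l. a l powr (2 * s) * (\<Sum>k\<in>Z l. (inner (\<psi> l k) f)\<^sup>2)) summable_on L}"


section \<open>The negative order space \<open>H(\<delta>)\<close>\<close>

text \<open>A linear form on the span of the basis is represented by its coefficient family, indexed by
  \<open>Sigma L Z\<close> and extended by \<open>0\<close> to all of \<open>int \<times> int\<close>.\<close>

type_synonym coeffs = "int \<times> int \<Rightarrow> real"

definition H_term ::
  "(int \<Rightarrow> int set) \<Rightarrow> (int \<Rightarrow> real) \<Rightarrow> real \<Rightarrow> coeffs \<Rightarrow> int \<Rightarrow> real" where
  "H_term Z a \<delta> x l = inverse (a l) * ln (a l) powr (- 2 * \<delta>) * (\<Sum>k\<in>Z l. (x (l, k))\<^sup>2)"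

definition H_space ::
  "int set \<Rightarrow> (int \<Rightarrow> int set) \<Rightarrow> (int \<Rightarrow> real) \<Rightarrow> real \<Rightarrow> coeffs set" where
  "H_space L Z a \<delta> = {x. (\<forall>p. p \<notin> Sigma L Z \<longrightarrow> x p = 0) \<and> H_term Z a \<delta> x summable_on L}"

definition H_norm ::
  "int set \<Rightarrow> (int \<Rightarrow> int set) \<Rightarrow> (int \<Rightarrow> real) \<Rightarrow> real \<Rightarrow> coeffs \<Rightarrow> real" where
  "H_norm L Z a \<delta> x = sqrt (infsum (H_term Z a \<delta> x) L)"

definition H_dist ::
  "int set \<Rightarrow> (int \<Rightarrow> int set) \<Rightarrow> (int \<Rightarrow> real) \<Rightarrow> real \<Rightarrow> coeffs \<Rightarrow> coeffs \<Rightarrow> real" where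
  "H_dist L Z a \<delta> x y = H_norm L Z a \<delta> (\<lambda>p. x p - y p)"

definition H_borel ::
  "int set \<Rightarrow> (int \<Rightarrow> int set) \<Rightarrow> (int \<Rightarrow> real) \<Rightarrow> real \<Rightarrow> coeffs measure" where
  "H_borel L Z a \<delta> = sigma (H_space L Z a \<delta>)
     {U. openin (Metric_space.mtopology (H_space L Z a \<delta>) (H_dist L Z a \<delta>)) U}"

definition coeffs_of ::
  "int set \<Rightarrow> (int \<Rightarrow> int set) \<Rightarrow> (int \<Rightarrow> int \<Rightarrow> L2) \<Rightarrow> L2 \<Rightarrow> coeffs" where
  "coeffs_of L Z \<psi> f = (\<lambda>(l, k). if (l, k) \<in> Sigma L Z then inner f (\<psi> l k) else 0)"

lemma regular_basis_ge_2:
  assumes "regular_basis S L Z a \<psi>" "l \<in> L"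
  shows "a l \<ge> 2" and "finite (Z l)"
proof -
  have "(2::real) ^ 1 \<le> 2 ^ nat l" if "l \<ge> 1"
    using that by (intro power_increasing) auto
  then show "a l \<ge> 2"
    using assms by (fastforce simp: regular_basis_def)
  have "card (Z l) \<noteq> 0"
    using assms by (fastforce simp: regular_basis_def)
  then show "finite (Z l)"
    by (metis card.infinite)
qed

lemma H_metric_space:
  assumes "regular_basis S L Z a \<psi>"
  shows "Metric_space (H_space L Z a \<delta>) (H_dist L Z a \<delta>)"
proof -
  define w where "w l = inverse (a l) * ln (a l) powr (- 2 * \<delta>)" for l
  have w: "w l > 0" if "l \<in> L" for l
    using regular_basis_ge_2[OF assms that] by (simp add: w_def)
  have fin: "finite (Z l)" if "l \<in> L" for l
    using regular_basis_ge_2[OF assms that] by simp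
  have term_eq: "H_term Z a \<delta> x l = (\<Sum>k\<in>Z l. (sqrt (w l) * x (l, k))\<^sup>2)" if "l \<in> L" for x l
  proof -
    have "H_term Z a \<delta> x l = w l * (\<Sum>k\<in>Z l. (x (l, k))\<^sup>2)"
      by (simp only: H_term_def w_def)
    then show ?thesis
      using w[OF that] by (simp add: sum_distrib_left power_mult_distrib)
  qed
  have nonneg: "H_term Z a \<delta> x l \<ge> 0" if "l \<in> L" for x l
    using that by (simp add: term_eq sum_nonneg)
  have part_eq: "sqrt (sum (H_term Z a \<delta> x) F)
      = L2_set (\<lambda>(l, k). sqrt (w l) * x (l, k)) (Sigma F Z)"
    if "finite F" "F \<subseteq> L" for x F
  proof -
    have "sum (H_term Z a \<delta> x) F = (\<Sum>l\<in>F. \<Sum>k\<in>Z l. (sqrt (w l) * x (l, k))\<^sup>2)"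
      using that by (intro sum.cong) (auto simp: term_eq)
    also have "\<dots> = (\<Sum>(l, k)\<in>Sigma F Z. (sqrt (w l) * x (l, k))\<^sup>2)"
      using that fin by (intro sum.Sigma) auto
    finally show ?thesis
      by (simp add: L2_set_def case_prod_beta)
  qed
  have part_le: "sqrt (sum (H_term Z a \<delta> x) F) \<le> H_norm L Z a \<delta> x"
    if "finite F" "F \<subseteq> L" "H_term Z a \<delta> x summable_on L" for x F
    unfolding H_norm_def
    using that nonneg by (intro real_sqrt_le_mono finite_sum_le_infsum) auto
  have part_add: "sum (H_term Z a \<delta> (\<lambda>p. x p + y p)) F \<le> (H_norm L Z a \<delta> x + H_norm L Z a \<delta> y)\<^sup>2"
    if F: "finite F" "F \<subseteq> L" and xy: "H_term Z a \<delta> x summable_on L" "H_term Z a \<delta> y summable_on L"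
    for x y F
  proof -
    have "sqrt (sum (H_term Z a \<delta> (\<lambda>p. x p + y p)) F)
        = L2_set (\<lambda>p. (case p of (l, k) \<Rightarrow> sqrt (w l) * x (l, k)) +
            (case p of (l, k) \<Rightarrow> sqrt (w l) * y (l, k))) (Sigma F Z)"
      unfolding part_eq[OF F] by (rule L2_set_cong) (auto simp: distrib_left)
    also have "\<dots> \<le> sqrt (sum (H_term Z a \<delta> x) F) + sqrt (sum (H_term Z a \<delta> y) F)"
      unfolding part_eq[OF F] by (rule L2_set_triangle_ineq)
    also have "\<dots> \<le> H_norm L Z a \<delta> x + H_norm L Z a \<delta> y"
      by (intro add_mono part_le F xy)
    finally show ?thesis
      by (rule sqrt_le_D)
  qed
  have summable_add: "H_term Z a \<delta> (\<lambda>p. x p + y p) summable_on L"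
    if "H_term Z a \<delta> x summable_on L" "H_term Z a \<delta> y summable_on L" for x y
    using part_add[OF _ _ that] nonneg
    by (intro nonneg_bdd_above_summable_on bdd_aboveI) auto
  have norm_nonneg: "H_norm L Z a \<delta> x \<ge> 0" for x
    unfolding H_norm_def using nonneg by (simp add: infsum_nonneg)
  have norm_add: "H_norm L Z a \<delta> (\<lambda>p. x p + y p) \<le> H_norm L Z a \<delta> x + H_norm L Z a \<delta> y"
    if "H_term Z a \<delta> x summable_on L" "H_term Z a \<delta> y summable_on L" for x y
  proof -
    have "infsum (H_term Z a \<delta> (\<lambda>p. x p + y p)) L \<le> (H_norm L Z a \<delta> x + H_norm L Z a \<delta> y)\<^sup>2"
      by (rule infsum_le_finite_sums[OF summable_add[OF that]]) (use part_add[OF _ _ that] in auto)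
    then show ?thesis
      unfolding H_norm_def[of L Z a \<delta> "\<lambda>p. x p + y p"]
      using norm_nonneg by (intro real_le_lsqrt) auto
  qed
  have neg: "H_term Z a \<delta> (\<lambda>p. y p - x p) = H_term Z a \<delta> (\<lambda>p. x p - y p)" for x y
    by (rule ext) (simp add: H_term_def power2_commute)
  have summable_diff: "H_term Z a \<delta> (\<lambda>p. x p - y p) summable_on L"
    if "x \<in> H_space L Z a \<delta>" "y \<in> H_space L Z a \<delta>" for x y
  proof -
    have "H_term Z a \<delta> (\<lambda>p. - y p) = H_term Z a \<delta> y"
      by (rule ext) (simp add: H_term_def)
    then show ?thesis
      using summable_add[of x "\<lambda>p. - y p"] that by (simp add: H_space_def)
  qed
  show ?thesis
  proof
    fix x y z
    show "0 \<le> H_dist L Z a \<delta> x y"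
      by (simp add: H_dist_def norm_nonneg)
    show "H_dist L Z a \<delta> x y = H_dist L Z a \<delta> y x"
      by (simp only: H_dist_def H_norm_def neg[of x y])
    assume x: "x \<in> H_space L Z a \<delta>" and y: "y \<in> H_space L Z a \<delta>"
    show "H_dist L Z a \<delta> x y = 0 \<longleftrightarrow> x = y"
    proof
      assume "H_dist L Z a \<delta> x y = 0"
      then have inf0: "infsum (H_term Z a \<delta> (\<lambda>p. x p - y p)) L \<le> 0"
        by (simp add: H_dist_def H_norm_def)
      have "x (l, k) = y (l, k)" if "l \<in> L" "k \<in> Z l" for l k
      proof -
        have "H_term Z a \<delta> (\<lambda>p. x p - y p) l = 0"
          using nonneg_infsum_le_0D[OF inf0 summable_diff[OF x y]] nonneg that by blast
        then have "(\<Sum>k\<in>Z l. (sqrt (w l) * (x (l, k) - y (l, k)))\<^sup>2) = 0"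
          using that by (simp add: term_eq)
        then have "(sqrt (w l) * (x (l, k) - y (l, k)))\<^sup>2 = 0"
          using that fin by (subst (asm) sum_nonneg_eq_0_iff) auto
        then show ?thesis
          using w[OF that(1)] by simp
      qed
      moreover have "x p = y p" if "p \<notin> Sigma L Z" for p
        using x y that by (cases p) (auto simp: H_space_def)
      ultimately show "x = y" by (metis (no_types, lifting) SigmaE ext)
    next
      assume "x = y"
      then show "H_dist L Z a \<delta> x y = 0"
        by (simp add: H_dist_def H_norm_def H_term_def infsum_0)
    qed
    assume z: "z \<in> H_space L Z a \<delta>"
    show "H_dist L Z a \<delta> x z \<le> H_dist L Z a \<delta> x y + H_dist L Z a \<delta> y z"
      using norm_add[OF summable_diff[OF x y] summable_diff[OF y z]]
      by (simp add: H_dist_def)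
  qed
qed


section \<open>The white noise model\<close>

definition white_noise ::
  "int set \<Rightarrow> (int \<Rightarrow> int set) \<Rightarrow> (int \<Rightarrow> real) \<Rightarrow> real \<Rightarrow> 'w measure \<Rightarrow> ('w \<Rightarrow> coeffs) \<Rightarrow> bool" where
  "white_noise L Z a \<delta> M W \<longleftrightarrow> prob_space M \<and>
     W \<in> measurable M (H_borel L Z a \<delta>) \<and>
     prob_space.indep_vars M (\<lambda>_. borel) (\<lambda>p \<omega>. W \<omega> p) (Sigma L Z) \<and>
     (\<forall>p\<in>Sigma L Z. distributed M lborel (\<lambda>\<omega>. W \<omega> p) std_normal_density)"

definition white_noise_law ::
  "int set \<Rightarrow> (int \<Rightarrow> int set) \<Rightarrow> (int \<Rightarrow> real) \<Rightarrow> real \<Rightarrow> 'w measure \<Rightarrow> ('w \<Rightarrow> coeffs) \<Rightarrow> coeffs measure" where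
  "white_noise_law L Z a \<delta> M W = distr M (H_borel L Z a \<delta>) W"

definition obs_law ::
  "int set \<Rightarrow> (int \<Rightarrow> int set) \<Rightarrow> (int \<Rightarrow> real) \<Rightarrow> (int \<Rightarrow> int \<Rightarrow> L2) \<Rightarrow> real \<Rightarrow>
   'w measure \<Rightarrow> ('w \<Rightarrow> coeffs) \<Rightarrow> nat \<Rightarrow> L2 \<Rightarrow> coeffs measure" where
  "obs_law L Z a \<psi> \<delta> M W n f =
     distr M (H_borel L Z a \<delta>) (\<lambda>\<omega> p. coeffs_of L Z \<psi> f p + W \<omega> p / sqrt (real n))"

text \<open>\<open>K\<close> is a regular conditional law of \<open>f\<close> given the observation \<open>X\<close> with values in the space
  \<open>HB\<close>, if \<open>f\<close> has law \<open>Prior\<close> and \<open>X\<close> given \<open>f\<close> has law \<open>P f\<close>: the two sides below are the probability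
  of \<open>f \<in> B, X \<in> A\<close> and the expectation of \<open>K X B\<close> over the event \<open>X \<in> A\<close>. This determines \<open>K\<close> only
  up to null sets of the marginal law of \<open>X\<close>.\<close>

definition is_posterior ::
  "'x measure \<Rightarrow> (L2 \<Rightarrow> 'x measure) \<Rightarrow> L2 measure \<Rightarrow> ('x \<Rightarrow> L2 measure) \<Rightarrow> bool" where
  "is_posterior HB P Prior K \<longleftrightarrow>
     K \<in> measurable HB (prob_algebra borel) \<and>
     (\<forall>A\<in>sets HB. \<forall>B\<in>sets borel.
        (\<integral>\<^sup>+ f. emeasure (P f) A * indicator B f \<partial>Prior) =
        (\<integral>\<^sup>+ f. (\<integral>\<^sup>+ x. emeasure (K x) B * indicator A x \<partial>P f) \<partial>Prior))"


section \<open>Convergence in probability and the weak Bernstein--von Mises phenomenon\<close>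

text \<open>The events are measured by the outer measure, which is the probability if they are measurable,
  so that the notion does not silently hold for a \<open>Y\<close> that is not measurable.\<close>

definition tendsto_0_in_prob :: "(nat \<Rightarrow> 'x measure) \<Rightarrow> (nat \<Rightarrow> 'x \<Rightarrow> real) \<Rightarrow> bool" where
  "tendsto_0_in_prob P Y \<longleftrightarrow>
     (\<forall>\<epsilon>>0. (\<lambda>n. outer_measure_of (P n) {x \<in> space (P n). \<bar>Y n x\<bar> > \<epsilon>}) \<longlonglongrightarrow> 0)"

text \<open>The constants \<open>b\<close> and \<open>c\<close> bound the sup-norm and the Lipschitz constant of \<open>u\<close>.\<close>

definition BL_ball :: "'x set \<Rightarrow> ('x \<Rightarrow> 'x \<Rightarrow> real) \<Rightarrow> ('x \<Rightarrow> real) set" where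
  "BL_ball X d = {u. \<exists>b c. 0 \<le> b \<and> 0 \<le> c \<and> b + c \<le> 1 \<and> (\<forall>x\<in>X. \<bar>u x\<bar> \<le> b) \<and>
     (\<forall>x\<in>X. \<forall>y\<in>X. \<bar>u x - u y\<bar> \<le> c * d x y)}"

definition BL_metric ::
  "'x set \<Rightarrow> ('x \<Rightarrow> 'x \<Rightarrow> real) \<Rightarrow> 'x measure \<Rightarrow> 'x measure \<Rightarrow> real" where
  "BL_metric X d \<mu> \<nu> = (SUP u\<in>BL_ball X d. \<bar>(\<integral>x. u x \<partial>\<mu>) - (\<integral>x. u x \<partial>\<nu>)\<bar>)"

definition rescale :: "nat \<Rightarrow> coeffs \<Rightarrow> coeffs \<Rightarrow> coeffs" where
  "rescale n z f = (\<lambda>p. sqrt (real n) * (f p - z p))"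

definition weak_BvM ::
  "int set \<Rightarrow> (int \<Rightarrow> int set) \<Rightarrow> (int \<Rightarrow> real) \<Rightarrow> (int \<Rightarrow> int \<Rightarrow> L2) \<Rightarrow> real \<Rightarrow>
   'w measure \<Rightarrow> ('w \<Rightarrow> coeffs) \<Rightarrow> L2 \<Rightarrow> (nat \<Rightarrow> coeffs \<Rightarrow> L2 measure) \<Rightarrow> bool" where
  "weak_BvM L Z a \<psi> \<delta> M W f0 K \<longleftrightarrow>
     tendsto_0_in_prob (\<lambda>n. obs_law L Z a \<psi> \<delta> M W n f0)
       (\<lambda>n x. BL_metric (H_space L Z a \<delta>) (H_dist L Z a \<delta>)
          (distr (K n x) (H_borel L Z a \<delta>) (\<lambda>f. rescale n x (coeffs_of L Z \<psi> f)))
          (white_noise_law L Z a \<delta> M W))"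

end

theory Submission
  imports Defs
begin

text \<open>The representer \<open>\<Psi>'\<close> lies in the dual of \<open>H(\<delta>)\<close> because \<open>s > 1/2\<close>, so pairing with it is a Lipschitz
  functional \<open>T\<close> on \<open>H(\<delta>)\<close>, and \<open>T(W)\<close> is a centred normal variable. Up to the quadratic remainder,
  \<open>\<surd>n (\<Psi> f - \<Psi> f0)\<close> is \<open>T\<close> of the rescaled posterior draw plus \<open>T(W)\<close>, so the weak Bernstein--von Mises
  property, tested on ramp functions of \<open>T\<close>, shows that the normal distribution function at the
  centred and rescaled posterior quantiles converges to the quantile levels in probability. The
  same centring turns \<open>\<Psi> f0\<close> into exactly \<open>- T(W)\<close>, whose law is the same normal law.\<close>

section \<open>The space \<open>H(\<delta>)\<close> and its dual pairing\<close>

text \<open>The quantiles are functions of the data, so the comparison of posterior half spaces with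
  normal ones must hold at all levels at once. Ramps of a fixed width \<eta> have the same Lipschitz
  constant at every level, so a single bounded Lipschitz distance controls them all. Passing between
  ramps and indicators shifts the level by \<eta>, which costs a multiple of \<eta> because the
  limiting normal law has a Lipschitz distribution function; this is where the representer has to be
  nonzero. The Lipschitz constant of the ramps blows up as \<eta> tends to 0, so \<eta> is fixed
  before n grows. On the sampling side no limit is taken: \<surd>n times the centred observation is
  white noise for each n \<ge> 1. What remains is a normal variable of exactly known law between two
  random endpoints, which may depend on it arbitrarily.\<close>

lemma summable_on_Sigma_finite_iff:
  fixes g :: "'a \<times> 'b \<Rightarrow> real"
  assumes nonneg: "\<And>p. p \<in> Sigma A B \<Longrightarrow> 0 \<le> g p" and fin: "\<And>x. x \<in> A \<Longrightarrow> finite (B x)"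
  shows "g summable_on Sigma A B \<longleftrightarrow> (\<lambda>x. \<Sum>y\<in>B x. g (x, y)) summable_on A"
proof
  have *: "(\<Sum>\<^sub>\<infinity>y\<in>B x. g (x, y)) = (\<Sum>y\<in>B x. g (x, y))" if "x \<in> A" for x
    using fin[OF that] by simp
  {
    assume "g summable_on Sigma A B"
    then have "(\<lambda>x. \<Sum>\<^sub>\<infinity>y\<in>B x. g (x, y)) summable_on A"
      by (intro summable_on_Sigma_banach) simp
    then show "(\<lambda>x. \<Sum>y\<in>B x. g (x, y)) summable_on A"
      using * by (simp cong: summable_on_cong)
  next
    assume "(\<lambda>x. \<Sum>y\<in>B x. g (x, y)) summable_on A"
    then show "g summable_on Sigma A B"
      by (intro summable_on_SigmaI[where g = "\<lambda>x. \<Sum>y\<in>B x. g (x, y)"])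
        (use nonneg fin in \<open>auto intro!: has_sum_finiteI\<close>)
  }
qed

lemma infsum_Sigma_finite:
  fixes g :: "'a \<times> 'b \<Rightarrow> real"
  assumes "g summable_on Sigma A B" and fin: "\<And>x. x \<in> A \<Longrightarrow> finite (B x)"
  shows "infsum g (Sigma A B) = (\<Sum>\<^sub>\<infinity>x\<in>A. \<Sum>y\<in>B x. g (x, y))"
proof -
  have "(\<Sum>\<^sub>\<infinity>x\<in>A. \<Sum>\<^sub>\<infinity>y\<in>B x. g (x, y)) = (\<Sum>\<^sub>\<infinity>x\<in>A. \<Sum>y\<in>B x. g (x, y))"
    using fin by (intro infsum_cong) simp
  then show ?thesis
    using infsum_Sigma_banach[OF assms(1)] by simp
qed

lemma Cauchy_Schwarz_infsum:
  fixes u v :: "'a \<Rightarrow> real"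
  assumes u: "(\<lambda>p. (u p)\<^sup>2) summable_on A" and v: "(\<lambda>p. (v p)\<^sup>2) summable_on A"
  shows "(\<lambda>p. u p * v p) summable_on A"
    and "\<bar>\<Sum>\<^sub>\<infinity>p\<in>A. u p * v p\<bar> \<le> sqrt (\<Sum>\<^sub>\<infinity>p\<in>A. (u p)\<^sup>2) * sqrt (\<Sum>\<^sub>\<infinity>p\<in>A. (v p)\<^sup>2)"
proof -
  let ?K = "sqrt (\<Sum>\<^sub>\<infinity>p\<in>A. (u p)\<^sup>2) * sqrt (\<Sum>\<^sub>\<infinity>p\<in>A. (v p)\<^sup>2)"
  have fin: "(\<Sum>p\<in>F. \<bar>u p * v p\<bar>) \<le> ?K" if "finite F" "F \<subseteq> A" for F
  proof -
    have "(\<Sum>p\<in>F. \<bar>u p * v p\<bar>) \<le> sqrt (\<Sum>p\<in>F. (u p)\<^sup>2) * sqrt (\<Sum>p\<in>F. (v p)\<^sup>2)"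
      using L2_set_mult_ineq[of u v F] by (simp add: L2_set_def abs_mult)
    also have "\<dots> \<le> ?K"
      using that u v by (intro mult_mono real_sqrt_le_mono finite_sum_le_infsum)
        (auto intro: infsum_nonneg sum_nonneg)
    finally show ?thesis .
  qed
  have abs: "(\<lambda>p. \<bar>u p * v p\<bar>) summable_on A"
    using fin by (intro nonneg_bdd_above_summable_on bdd_aboveI[of _ ?K]) auto
  then show "(\<lambda>p. u p * v p) summable_on A"
    using abs_summable_summable[of "\<lambda>p. u p * v p" A] by simp
  have "\<bar>\<Sum>\<^sub>\<infinity>p\<in>A. u p * v p\<bar> \<le> (\<Sum>\<^sub>\<infinity>p\<in>A. \<bar>u p * v p\<bar>)"
    using norm_infsum_bound[of "\<lambda>p. u p * v p" A] abs by simp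
  also have "\<dots> \<le> ?K"
    using fin by (intro infsum_le_finite_sums[OF abs]) auto
  finally show "\<bar>\<Sum>\<^sub>\<infinity>p\<in>A. u p * v p\<bar> \<le> ?K" .
qed

lemma Bessel_inequality_finite:
  fixes e :: "'i \<Rightarrow> 'a::real_inner"
  assumes "finite F" and ortho: "\<And>p q. p \<in> F \<Longrightarrow> q \<in> F \<Longrightarrow> inner (e p) (e q) = (if p = q then 1 else 0)"
  shows "(\<Sum>p\<in>F. (inner f (e p))\<^sup>2) \<le> (norm f)\<^sup>2"
proof -
  let ?g = "\<Sum>p\<in>F. inner f (e p) *\<^sub>R e p"
  have gg: "inner ?g ?g = (\<Sum>p\<in>F. (inner f (e p))\<^sup>2)"
  proof -
    have "inner ?g ?g = (\<Sum>p\<in>F. \<Sum>q\<in>F. inner f (e p) * (inner f (e q) * inner (e q) (e p)))"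
      by (simp add: inner_sum_left inner_sum_right sum_distrib_left)
    also have "\<dots> = (\<Sum>p\<in>F. \<Sum>q\<in>F. if q = p then inner f (e p) * inner f (e q) else 0)"
      by (intro sum.cong refl) (auto simp: ortho)
    finally show ?thesis
      using assms(1) by (simp add: power2_eq_square)
  qed
  have fg: "inner f ?g = (\<Sum>p\<in>F. (inner f (e p))\<^sup>2)"
    by (simp add: inner_sum_right power2_eq_square)
  have "0 \<le> inner (f - ?g) (f - ?g)"
    by simp
  also have "\<dots> = (norm f)\<^sup>2 - (\<Sum>p\<in>F. (inner f (e p))\<^sup>2)"
    using gg fg by (simp add: inner_diff_left inner_diff_right inner_commute[of ?g f] power2_norm_eq_inner)
  finally show ?thesis by simp
qed

text \<open>The sigma algebra lives on the carrier of a metric space rather than on a topological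
  type. Preimages of open sets are open in the carrier and hence are generators.\<close>

lemma (in Metric_space) Lipschitz_imp_borel_measurable:
  fixes \<phi> :: "'a \<Rightarrow> real"
  assumes "\<And>x y. x \<in> M \<Longrightarrow> y \<in> M \<Longrightarrow> \<bar>\<phi> x - \<phi> y\<bar> \<le> c * d x y"
  shows "\<phi> \<in> borel_measurable (sigma M {U. openin mtopology U})"
proof (rule borel_measurableI)
  fix T :: "real set" assume "open T"
  have "openin mtopology (\<phi> -` T \<inter> M)"
    unfolding openin_mtopology
  proof (intro conjI allI impI)
    fix x assume x: "x \<in> \<phi> -` T \<inter> M"
    then obtain e where e: "e > 0" "\<And>y. \<bar>y - \<phi> x\<bar> < e \<Longrightarrow> y \<in> T"
      using \<open>open T\<close> by (auto simp: open_dist dist_real_def)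
    \<comment> \<open>The absolute value and the added 1 make the radius positive whatever the sign
      of \<open>c\<close>, including \<open>c = 0\<close>.\<close>
    have "y \<in> \<phi> -` T \<inter> M" if "y \<in> mball x (e / (\<bar>c\<bar> + 1))" for y
    proof -
      have y: "y \<in> M" "d x y < e / (\<bar>c\<bar> + 1)"
        using that by auto
      have "\<bar>\<phi> y - \<phi> x\<bar> \<le> c * d x y"
        using assms[of x y] x y by (simp add: abs_minus_commute)
      also have "\<dots> \<le> (\<bar>c\<bar> + 1) * d x y"
        by (intro mult_right_mono) auto
      also have "\<dots> < e"
        using y(2) by (simp add: field_simps)
      finally show ?thesis
        using e(2) y(1) by simp
    qed
    then show "\<exists>r>0. mball x r \<subseteq> \<phi> -` T \<inter> M"
      using \<open>e > 0\<close> by (intro exI[of _ "e / (\<bar>c\<bar> + 1)"]) (auto simp: add_nonneg_pos)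
  qed auto
  then show "\<phi> -` T \<inter> space (sigma M {U. openin mtopology U}) \<in> sets (sigma M {U. openin mtopology U})"
    using openin_subset[of mtopology] by (auto simp: space_measure_of_conv intro!: sigma_sets.Basic)
qed

section \<open>The weighted sequence space over the basis indices\<close>

locale regular_basis_scale =
  fixes S :: nat and L :: "int set" and Z :: "int \<Rightarrow> int set" and a :: "int \<Rightarrow> real"
    and \<psi> :: "int \<Rightarrow> int \<Rightarrow> L2" and \<delta> :: real
  assumes basis: "regular_basis S L Z a \<psi>"
begin

text \<open>Each level has finitely many indices, so nested sums over levels may be flattened to
  sums over pairs. One index set then serves Cauchy--Schwarz, Bessel's inequality and the Gaussian
  series alike.\<close>

definition idx :: "(int \<times> int) set" where "idx = Sigma L Z"

definition weight :: "int \<times> int \<Rightarrow> real" where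
  "weight p = inverse (a (fst p)) * ln (a (fst p)) powr (- 2 * \<delta>)"

abbreviation H :: "coeffs set" where "H \<equiv> H_space L Z a \<delta>"
abbreviation nrm :: "coeffs \<Rightarrow> real" where "nrm \<equiv> H_norm L Z a \<delta>"
abbreviation HB :: "coeffs measure" where "HB \<equiv> H_borel L Z a \<delta>"
abbreviation cf :: "L2 \<Rightarrow> coeffs" where "cf \<equiv> coeffs_of L Z \<psi>"

definition pairing :: "coeffs \<Rightarrow> coeffs \<Rightarrow> real" where
  "pairing c x = (\<Sum>\<^sub>\<infinity>p\<in>idx. c p * x p)"

lemma a_ge_2: "p \<in> idx \<Longrightarrow> 2 \<le> a (fst p)"
  using regular_basis_ge_2(1)[OF basis] by (auto simp: idx_def)

lemma finite_Z: "l \<in> L \<Longrightarrow> finite (Z l)"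
  using regular_basis_ge_2(2)[OF basis] .

lemma weight_pos: "p \<in> idx \<Longrightarrow> 0 < weight p"
  using a_ge_2[of p] by (simp add: weight_def)

lemma H_term_eq: "H_term Z a \<delta> x l = (\<Sum>k\<in>Z l. weight (l, k) * (x (l, k))\<^sup>2)"
  by (simp add: H_term_def weight_def sum_distrib_left)

lemma H_term_summable_iff:
  "H_term Z a \<delta> x summable_on L \<longleftrightarrow> (\<lambda>p. weight p * (x p)\<^sup>2) summable_on idx"
  unfolding idx_def H_term_eq[abs_def]
  by (rule summable_on_Sigma_finite_iff[symmetric])
    (use weight_pos finite_Z in \<open>auto simp: idx_def less_imp_le\<close>)

lemma mem_H_iff: "x \<in> H \<longleftrightarrow> (\<forall>p. p \<notin> idx \<longrightarrow> x p = 0) \<and> (\<lambda>p. weight p * (x p)\<^sup>2) summable_on idx"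
  unfolding H_space_def by (simp add: H_term_summable_iff idx_def)

lemma nrm_eq:
  assumes "x \<in> H"
  shows "nrm x = sqrt (\<Sum>\<^sub>\<infinity>p\<in>idx. weight p * (x p)\<^sup>2)"
  using assms infsum_Sigma_finite[of "\<lambda>p. weight p * (x p)\<^sup>2" L Z] finite_Z
  by (simp add: mem_H_iff H_norm_def H_term_eq[abs_def] idx_def)

lemma H_lincomb:
  assumes "x \<in> H" "y \<in> H"
  shows "(\<lambda>p. b * x p + c * y p) \<in> H"
proof -
  have "(\<lambda>p. 2 * b\<^sup>2 * (weight p * (x p)\<^sup>2) + 2 * c\<^sup>2 * (weight p * (y p)\<^sup>2)) summable_on idx"
    using assms by (intro summable_on_add summable_on_cmult_right) (auto simp: mem_H_iff)
  moreover have "weight p * (b * x p + c * y p)\<^sup>2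
      \<le> 2 * b\<^sup>2 * (weight p * (x p)\<^sup>2) + 2 * c\<^sup>2 * (weight p * (y p)\<^sup>2)" if "p \<in> idx" for p
  proof -
    have "(u + v)\<^sup>2 \<le> 2 * u\<^sup>2 + 2 * v\<^sup>2" for u v :: real
      using sum_squares_bound[of u v] by (simp add: power2_sum)
    from mult_left_mono[OF this[of "b * x p" "c * y p"], of "weight p"] weight_pos[OF that]
    show ?thesis by (simp add: power_mult_distrib algebra_simps)
  qed
  ultimately have "(\<lambda>p. weight p * (b * x p + c * y p)\<^sup>2) summable_on idx"
    by (rule summable_on_comparison_test) (auto simp: less_imp_le[OF weight_pos])
  then show ?thesis
    using assms by (auto simp: mem_H_iff)
qed

lemma H_scale: "x \<in> H \<Longrightarrow> (\<lambda>p. b * x p) \<in> H"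
  using H_lincomb[of x x b 0] by simp

lemma H_diff: "x \<in> H \<Longrightarrow> y \<in> H \<Longrightarrow> (\<lambda>p. x p - y p) \<in> H"
  using H_lincomb[of x y 1 "-1"] by simp

lemma nrm_scale: "nrm (\<lambda>p. b * x p) = \<bar>b\<bar> * nrm x"
proof -
  have "H_term Z a \<delta> (\<lambda>p. b * x p) = (\<lambda>l. b\<^sup>2 * H_term Z a \<delta> x l)"
    by (rule ext) (simp add: H_term_eq power_mult_distrib sum_distrib_left mult_ac)
  then show ?thesis
    by (simp add: H_norm_def infsum_cmult_right' real_sqrt_mult)
qed

lemma orthonormal:
  assumes "p \<in> idx" "q \<in> idx"
  shows "inner (case_prod \<psi> p) (case_prod \<psi> q) = (if p = q then 1 else 0)"
proof -
  have *: "\<forall>(l, k)\<in>Sigma L Z. \<forall>(l', k')\<in>Sigma L Z.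
        inner (\<psi> l k) (\<psi> l' k') = (if (l, k) = (l', k') then 1 else 0)"
    using basis unfolding regular_basis_def orthonormal_basis_def by blast
  have "(\<lambda>(l, k). \<forall>(l', k')\<in>Sigma L Z.
        inner (\<psi> l k) (\<psi> l' k') = (if (l, k) = (l', k') then 1 else 0)) p"
    by (rule bspec[OF *]) (use assms(1) idx_def in simp)
  then have **: "\<forall>(l', k')\<in>Sigma L Z. inner (case_prod \<psi> p) (\<psi> l' k') = (if p = (l', k') then 1 else 0)"
    by (cases p) simp
  have "(\<lambda>(l', k'). inner (case_prod \<psi> p) (\<psi> l' k') = (if p = (l', k') then 1 else 0)) q"
    by (rule bspec[OF **]) (use assms(2) idx_def in simp)
  then show ?thesis by (cases q) simp
qed

lemma dense_span: "closure (span (case_prod \<psi> ` idx)) = UNIV"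
proof -
  have "case_prod \<psi> ` idx = {\<psi> l k | l k. (l, k) \<in> Sigma L Z}"
    by (force simp: idx_def image_iff)
  then show ?thesis
    using basis by (simp add: regular_basis_def orthonormal_basis_def)
qed

lemma coeffs_of_eq: "cf f p = (if p \<in> idx then inner f (case_prod \<psi> p) else 0)"
  by (cases p) (simp add: coeffs_of_def idx_def)

lemma coeffs_of_diff: "cf (f - g) = (\<lambda>p. cf f p - cf g p)"
  by (rule ext) (simp add: coeffs_of_eq inner_diff_left)

lemma coeffs_of_sum_le: "finite F \<Longrightarrow> F \<subseteq> idx \<Longrightarrow> (\<Sum>p\<in>F. (cf f p)\<^sup>2) \<le> (norm f)\<^sup>2"
  using Bessel_inequality_finite[of F "case_prod \<psi>" f, OF _ orthonormal]
  by (simp add: coeffs_of_eq subset_eq cong: sum.cong)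

lemma coeffs_of_sq_summable: "(\<lambda>p. (cf f p)\<^sup>2) summable_on idx"
  using coeffs_of_sum_le[of _ f]
  by (intro nonneg_bdd_above_summable_on bdd_aboveI[of _ "(norm f)\<^sup>2"]) auto

lemma coeffs_of_sq_infsum_le: "(\<Sum>\<^sub>\<infinity>p\<in>idx. (cf f p)\<^sup>2) \<le> (norm f)\<^sup>2"
  using coeffs_of_sum_le[of _ f] by (intro infsum_le_finite_sums coeffs_of_sq_summable) auto

end

lemma (in regular_basis_scale) weight_bounded:
  assumes "0 \<le> \<delta>" "p \<in> idx"
  shows "weight p \<le> inverse 2 * ln 2 powr (- 2 * \<delta>)"
proof -
  have "ln (a (fst p)) powr (- 2 * \<delta>) \<le> ln 2 powr (- 2 * \<delta>)"
    using a_ge_2[OF assms(2)] assms(1) by (intro powr_mono2') auto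
  moreover have "inverse (a (fst p)) \<le> inverse 2"
    using a_ge_2[OF assms(2)] by (intro le_imp_inverse_le) auto
  ultimately show ?thesis
    unfolding weight_def using a_ge_2[OF assms(2)] by (intro mult_mono) auto
qed

locale noise_space = regular_basis_scale +
  assumes \<delta>_nonneg: "0 \<le> \<delta>"
begin

text \<open>The square root of the bound on the weights; it bounds the norm of the embedding of
  L2.\<close>

definition emb :: real where "emb = sqrt (inverse 2 * ln 2 powr (- 2 * \<delta>))"

lemma emb_nonneg: "0 \<le> emb"
  by (simp add: emb_def)

lemma coeffs_of_in_H: "cf f \<in> H"
  and nrm_coeffs_of_le: "nrm (cf f) \<le> emb * norm f"
proof -
  let ?c = "inverse 2 * ln 2 powr (- 2 * \<delta>) :: real"
  have le: "weight p * (cf f p)\<^sup>2 \<le> ?c * (cf f p)\<^sup>2" if "p \<in> idx" for p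
    using weight_bounded[OF \<delta>_nonneg that] by (rule mult_right_mono) simp
  have sum: "(\<lambda>p. ?c * (cf f p)\<^sup>2) summable_on idx"
    by (intro summable_on_cmult_right coeffs_of_sq_summable)
  have sum': "(\<lambda>p. weight p * (cf f p)\<^sup>2) summable_on idx"
    using le by (intro summable_on_comparison_test[OF sum]) (auto simp: less_imp_le[OF weight_pos])
  then show H: "cf f \<in> H"
    by (auto simp: mem_H_iff coeffs_of_eq)
  have "(\<Sum>\<^sub>\<infinity>p\<in>idx. weight p * (cf f p)\<^sup>2) \<le> (\<Sum>\<^sub>\<infinity>p\<in>idx. ?c * (cf f p)\<^sup>2)"
    by (intro infsum_mono sum sum' le)
  also have "\<dots> = ?c * (\<Sum>\<^sub>\<infinity>p\<in>idx. (cf f p)\<^sup>2)"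
    by (rule infsum_cmult_right')
  also have "\<dots> \<le> ?c * (norm f)\<^sup>2"
    by (intro mult_left_mono coeffs_of_sq_infsum_le) auto
  finally show "nrm (cf f) \<le> emb * norm f"
    using real_sqrt_le_mono[of _ "?c * (norm f)\<^sup>2"]
    by (simp only: nrm_eq[OF H] emb_def real_sqrt_mult real_sqrt_abs abs_norm_cancel)
qed

interpretation H: Metric_space H "H_dist L Z a \<delta>"
  by (rule H_metric_space[OF basis])

lemma space_HB: "space HB = H"
  by (simp add: H_borel_def space_measure_of_conv)

lemma Lipschitz_measurable_HB:
  fixes \<phi> :: "coeffs \<Rightarrow> real"
  assumes "\<And>x y. x \<in> H \<Longrightarrow> y \<in> H \<Longrightarrow> \<bar>\<phi> x - \<phi> y\<bar> \<le> c * nrm (\<lambda>p. x p - y p)"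
  shows "\<phi> \<in> borel_measurable HB"
  using H.Lipschitz_imp_borel_measurable[of \<phi> c] assms
  by (simp add: H_borel_def H_dist_def)

text \<open>Two maps of this form matter: the one that makes an observation out of white noise and
  the one that rescales a posterior draw around the observation. Distances are multiplied by |b|, so
  the map is continuous.\<close>

lemma affine_measurable_HB:
  assumes "z \<in> H"
  shows "(\<lambda>x p. z p + b * x p) \<in> measurable HB HB"
  unfolding H_borel_def[of L Z a \<delta>]
proof (rule measurable_measure_of)
  let ?B = "sigma H {U. openin H.mtopology U}"
  let ?g = "\<lambda>x p. z p + b * x p :: real"
  show "{U. openin H.mtopology U} \<subseteq> Pow H"
    using openin_subset[of H.mtopology] by auto
  have g: "?g x \<in> H" if "x \<in> H" for x
    using H_lincomb[OF assms that, of 1 b] by simp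
  then show "?g \<in> space ?B \<rightarrow> H"
    by (auto simp: space_measure_of_conv)
  fix U assume U: "U \<in> {U. openin H.mtopology U}"
  have "openin H.mtopology (?g -` U \<inter> H)"
    unfolding H.openin_mtopology
  proof (intro conjI allI impI)
    fix x assume x: "x \<in> ?g -` U \<inter> H"
    then obtain e where e: "e > 0" "H.mball (?g x) e \<subseteq> U"
      using U by (auto simp: H.openin_mtopology)
    have "y \<in> ?g -` U \<inter> H" if "y \<in> H.mball x (e / (\<bar>b\<bar> + 1))" for y
    proof -
      have y: "y \<in> H" "H_dist L Z a \<delta> x y < e / (\<bar>b\<bar> + 1)"
        using that by auto
      have "H_dist L Z a \<delta> (?g x) (?g y) = \<bar>b\<bar> * H_dist L Z a \<delta> x y"
        unfolding H_dist_def by (simp add: right_diff_distrib[symmetric] nrm_scale)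
      also have "\<dots> \<le> (\<bar>b\<bar> + 1) * H_dist L Z a \<delta> x y"
        by (intro mult_right_mono) auto
      also have "\<dots> < e"
        using y(2) by (simp add: field_simps)
      finally show ?thesis
        using e(2) x y(1) g by auto
    qed
    then show "\<exists>r>0. H.mball x r \<subseteq> ?g -` U \<inter> H"
      using \<open>e > 0\<close> by (intro exI[of _ "e / (\<bar>b\<bar> + 1)"]) (auto simp: add_nonneg_pos)
  qed auto
  then show "?g -` U \<inter> space ?B \<in> sets ?B"
    using openin_subset[of H.mtopology] by (auto simp: space_measure_of_conv intro!: sigma_sets.Basic)
qed

lemma coeffs_of_measurable: "cf \<in> measurable borel HB"
  unfolding H_borel_def
proof (rule measurable_measure_of)
  show "{U. openin H.mtopology U} \<subseteq> Pow H"
    using openin_subset[of H.mtopology] by auto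
  show "cf \<in> space borel \<rightarrow> H"
    using coeffs_of_in_H by auto
  fix U assume U: "U \<in> {U. openin H.mtopology U}"
  have "open (cf -` U)"
    unfolding open_dist
  proof
    fix f assume "f \<in> cf -` U"
    then obtain e where e: "e > 0" "H.mball (cf f) e \<subseteq> U"
      using U by (auto simp: H.openin_mtopology)
    have "g \<in> cf -` U" if "dist g f < e / (emb + 1)" for g
    proof -
      have "H_dist L Z a \<delta> (cf f) (cf g) \<le> emb * dist g f"
        unfolding H_dist_def coeffs_of_diff[symmetric] dist_commute[of g f] dist_norm[of f g] by (rule nrm_coeffs_of_le)
      also have "\<dots> \<le> (emb + 1) * dist g f"
        by (intro mult_right_mono) auto
      also have "\<dots> < e"
        using that emb_nonneg by (simp add: field_simps)
      finally show ?thesis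
        using e(2) coeffs_of_in_H by auto
    qed
    then show "\<exists>e>0. \<forall>g. dist g f < e \<longrightarrow> g \<in> cf -` U"
      using \<open>e > 0\<close> emb_nonneg by (intro exI[of _ "e / (emb + 1)"]) (auto simp: add_nonneg_pos)
  qed
  then show "cf -` U \<inter> space borel \<in> sets borel"
    by simp
qed

end

section \<open>Continuous linear forms on the weighted space\<close>

locale dual_form = noise_space +
  fixes c :: coeffs
  assumes dual: "(\<lambda>p. (c p)\<^sup>2 / weight p) summable_on idx"
begin

text \<open>The norm of \<open>c\<close> in the dual space, whose weights are the reciprocals of
  those of \<open>H\<close>.\<close>

definition dnorm :: real where "dnorm = sqrt (\<Sum>\<^sub>\<infinity>p\<in>idx. (c p)\<^sup>2 / weight p)"

lemma dnorm_nonneg: "0 \<le> dnorm"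
  unfolding dnorm_def by (auto intro!: infsum_nonneg divide_nonneg_pos weight_pos)

text \<open>Cauchy--Schwarz after moving the square root of the weight from one factor to the other:
  the weights cancel in the product and leave the dual norm and the norm of \<open>H\<close>. The
  series converges at every point of \<open>H\<close>, so pairing with the noise involves no
  exceptional null set.\<close>

lemma pairing_summable: "x \<in> H \<Longrightarrow> (\<lambda>p. c p * x p) summable_on idx"
  and pairing_bound: "x \<in> H \<Longrightarrow> \<bar>pairing c x\<bar> \<le> dnorm * nrm x"
proof -
  assume x: "x \<in> H"
  let ?u = "\<lambda>p. c p / sqrt (weight p)" and ?v = "\<lambda>p. sqrt (weight p) * x p"
  have u: "(?u p)\<^sup>2 = (c p)\<^sup>2 / weight p" and v: "(?v p)\<^sup>2 = weight p * (x p)\<^sup>2"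
    and uv: "?u p * ?v p = c p * x p" if "p \<in> idx" for p
    using weight_pos[OF that] by (simp_all add: power_divide power_mult_distrib)
  have su: "(\<lambda>p. (?u p)\<^sup>2) summable_on idx"
    using dual u by (simp cong: summable_on_cong)
  have sv: "(\<lambda>p. (?v p)\<^sup>2) summable_on idx"
    using x v by (simp add: mem_H_iff cong: summable_on_cong)
  note CS = Cauchy_Schwarz_infsum[OF su sv]
  show "(\<lambda>p. c p * x p) summable_on idx"
    using CS(1) uv by (simp cong: summable_on_cong)
  have "(\<Sum>\<^sub>\<infinity>p\<in>idx. ?u p * ?v p) = pairing c x"
    unfolding pairing_def by (rule infsum_cong) (rule uv)
  moreover have "(\<Sum>\<^sub>\<infinity>p\<in>idx. (?u p)\<^sup>2) = (\<Sum>\<^sub>\<infinity>p\<in>idx. (c p)\<^sup>2 / weight p)"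
    by (rule infsum_cong) (rule u)
  moreover have "(\<Sum>\<^sub>\<infinity>p\<in>idx. (?v p)\<^sup>2) = (\<Sum>\<^sub>\<infinity>p\<in>idx. weight p * (x p)\<^sup>2)"
    by (rule infsum_cong) (rule v)
  ultimately show "\<bar>pairing c x\<bar> \<le> dnorm * nrm x"
    using CS(2) by (simp only: nrm_eq[OF x] dnorm_def)
qed

lemma pairing_lincomb:
  assumes "x \<in> H" "y \<in> H"
  shows "pairing c (\<lambda>p. b * x p + d * y p) = b * pairing c x + d * pairing c y"
proof -
  have "pairing c (\<lambda>p. b * x p + d * y p) = (\<Sum>\<^sub>\<infinity>p\<in>idx. b * (c p * x p) + d * (c p * y p))"
    unfolding pairing_def by (rule infsum_cong) (simp add: algebra_simps)
  also have "\<dots> = (\<Sum>\<^sub>\<infinity>p\<in>idx. b * (c p * x p)) + (\<Sum>\<^sub>\<infinity>p\<in>idx. d * (c p * y p))"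
    by (intro infsum_add summable_on_cmult_right pairing_summable assms)
  finally show ?thesis
    by (simp add: pairing_def infsum_cmult_right')
qed

lemma pairing_diff: "x \<in> H \<Longrightarrow> y \<in> H \<Longrightarrow> pairing c (\<lambda>p. x p - y p) = pairing c x - pairing c y"
  using pairing_lincomb[of x y 1 "-1"] by simp

lemma pairing_Lipschitz:
  "x \<in> H \<Longrightarrow> y \<in> H \<Longrightarrow> \<bar>pairing c x - pairing c y\<bar> \<le> dnorm * nrm (\<lambda>p. x p - y p)"
  using pairing_bound[OF H_diff[of x y]] by (simp add: pairing_diff)

lemma pairing_measurable: "pairing c \<in> borel_measurable HB"
  by (rule Lipschitz_measurable_HB) (rule pairing_Lipschitz)

end

section \<open>Pairings given by elements of L2\<close>

context noise_space
begin

text \<open>The difference of the two sides is a bounded linear functional of \<open>f\<close> that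
  vanishes on the basis by orthonormality, hence on the closure of its span. This lets the
  derivative of the functional be read off in the weaker space.\<close>

lemma pairing_coeffs_of:
  assumes "dual_form S L Z a \<psi> \<delta> (cf g)"
  shows "pairing (cf g) (cf f) = inner f g"
proof -
  interpret dual_form S L Z a \<psi> \<delta> "cf g" by fact
  define B where "B f = pairing (cf g) (cf f) - inner f g" for f
  have lin: "cf (b *\<^sub>R f + d *\<^sub>R h) = (\<lambda>p. b * cf f p + d * cf h p)" for b d f h
    by (rule ext) (simp add: coeffs_of_eq inner_add_left)
  have Blin: "B (b *\<^sub>R f + d *\<^sub>R h) = b * B f + d * B h" for b d f h
    using pairing_lincomb[OF coeffs_of_in_H coeffs_of_in_H, of b f d h]
    by (simp add: B_def lin inner_add_left algebra_simps)
  have "bounded_linear B"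
  proof (rule bounded_linear_intro)
    show "B (f + h) = B f + B h" for f h
      using Blin[of 1 f 1 h] by simp
    show "B (r *\<^sub>R f) = r *\<^sub>R B f" for r f
      using Blin[of r f 0 f] by simp
    fix f
    have "\<bar>pairing (cf g) (cf f)\<bar> \<le> dnorm * nrm (cf f)"
      by (rule pairing_bound[OF coeffs_of_in_H])
    also have "\<dots> \<le> dnorm * (emb * norm f)"
      by (intro mult_left_mono nrm_coeffs_of_le dnorm_nonneg)
    finally show "norm (B f) \<le> norm f * (dnorm * emb + norm g)"
      using Cauchy_Schwarz_ineq2[of f g] unfolding B_def by (simp add: algebra_simps)
  qed
  then interpret B: bounded_linear B .
  have "B (case_prod \<psi> p) = 0" if "p \<in> idx" for p
  proof -
    have "pairing (cf g) (cf (case_prod \<psi> p)) = (\<Sum>\<^sub>\<infinity>q\<in>{p}. cf g q * cf (case_prod \<psi> p) q)"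
      unfolding pairing_def
      by (rule infsum_cong_neutral) (use that in \<open>auto simp: coeffs_of_eq orthonormal split: if_splits\<close>)
    then show ?thesis
      using that by (simp add: B_def coeffs_of_eq orthonormal inner_commute)
  qed
  then have "span (case_prod \<psi> ` idx) \<subseteq> {f. B f = 0}"
    by (intro span_minimal) (auto simp: subspace_def B.add B.scaleR)
  moreover have "closed {f. B f = 0}"
    by (intro closed_Collect_eq B.continuous_on continuous_intros)
  ultimately have "closure (span (case_prod \<psi> ` idx)) \<subseteq> {f. B f = 0}"
    by (rule closure_minimal)
  then show ?thesis
    using dense_span by (auto simp: B_def)
qed

text \<open>Raise ln x \<le> x^d / d to the power 2 \<delta> with d = e / (2 \<delta> + 1). The 1 in
  the denominator covers \<delta> = 0 and makes the resulting exponent 2 \<delta> d at most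
  e.\<close>

lemma ln_powr_le_powr:
  fixes x :: real
  assumes "0 < e" "2 \<le> x"
  shows "ln x powr (2 * \<delta>) \<le> ((2 * \<delta> + 1) / e) powr (2 * \<delta>) * x powr e"
proof -
  let ?d = "e / (2 * \<delta> + 1)"
  have d: "?d > 0" using assms(1) \<delta>_nonneg by (intro divide_pos_pos) auto
  have "ln x \<le> x powr ?d / ?d"
    using ln_powr_bound[of x ?d] assms d by simp
  then have "ln x powr (2 * \<delta>) \<le> (x powr ?d / ?d) powr (2 * \<delta>)"
    using \<delta>_nonneg assms by (intro powr_mono2) auto
  also have "\<dots> = (inverse ?d) powr (2 * \<delta>) * x powr (?d * (2 * \<delta>))"
    using d by (simp add: divide_inverse powr_mult powr_powr mult.commute)
  also have "\<dots> \<le> (inverse ?d) powr (2 * \<delta>) * x powr e"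
  proof (intro mult_left_mono powr_mono)
    show "?d * (2 * \<delta>) \<le> e"
      using assms(1) \<delta>_nonneg by (simp add: field_simps)
  qed (use assms in auto)
  finally show ?thesis by simp
qed

text \<open>The reciprocal weight is \<open>a\<close> times a power of its logarithm. The surplus
  exponent 2 s - 1 > 0 absorbs the logarithm, and a constant times the Sobolev weight is
  left.\<close>

lemma sobolev_dual_form:
  assumes "1/2 < s" "g \<in> sobolev L Z a \<psi> s"
  shows "dual_form S L Z a \<psi> \<delta> (cf g)"
proof
  define K where "K = ((2 * \<delta> + 1) / (2 * s - 1)) powr (2 * \<delta>)"
  let ?t = "\<lambda>p. a (fst p) powr (2 * s) * (cf g p)\<^sup>2"
  have "(\<lambda>l. \<Sum>k\<in>Z l. ?t (l, k)) summable_on L"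
  proof (subst summable_on_cong)
    show "(\<Sum>k\<in>Z l. ?t (l, k)) = a l powr (2 * s) * (\<Sum>k\<in>Z l. (inner (\<psi> l k) g)\<^sup>2)" if "l \<in> L" for l
      using that by (simp add: sum_distrib_left coeffs_of_eq idx_def inner_commute)
    show "(\<lambda>l. a l powr (2 * s) * (\<Sum>k\<in>Z l. (inner (\<psi> l k) g)\<^sup>2)) summable_on L"
      using assms(2) by (simp add: sobolev_def)
  qed
  then have sum: "?t summable_on idx"
    unfolding idx_def using finite_Z by (subst summable_on_Sigma_finite_iff) auto
  have le: "(cf g p)\<^sup>2 / weight p \<le> K * ?t p" if "p \<in> idx" for p
  proof -
    let ?a = "a (fst p)"
    have a2: "?a \<ge> 2" using a_ge_2[OF that] .
    have "1 / weight p = ?a * ln ?a powr (2 * \<delta>)"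
      using a2 by (simp add: weight_def powr_minus field_simps)
    also have "\<dots> \<le> ?a * (K * ?a powr (2 * s - 1))"
      unfolding K_def using a2 assms(1) by (intro mult_left_mono ln_powr_le_powr) auto
    also have "\<dots> = K * ?a powr (2 * s)"
      using a2 by (simp add: powr_diff)
    finally have "(cf g p)\<^sup>2 * (1 / weight p) \<le> (cf g p)\<^sup>2 * (K * ?a powr (2 * s))"
      by (rule mult_left_mono) simp
    then show ?thesis by (simp add: mult_ac)
  qed
  show "(\<lambda>p. (cf g p)\<^sup>2 / weight p) summable_on idx"
    by (rule summable_on_comparison_test[OF summable_on_cmult_right[OF sum]])
      (use le in \<open>auto intro: divide_nonneg_pos weight_pos\<close>)
qed

text \<open>This is the variance of the limit law. If it vanished, \<open>g\<close> would be
  orthogonal to a dense subspace and therefore to itself.\<close>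

lemma infsum_coeffs_of_pos:
  assumes "g \<noteq> 0"
  shows "0 < (\<Sum>\<^sub>\<infinity>p\<in>idx. (cf g p)\<^sup>2)"
proof (rule ccontr)
  assume "\<not> ?thesis"
  then have le: "(\<Sum>\<^sub>\<infinity>p\<in>idx. (cf g p)\<^sup>2) \<le> 0" by simp
  have "(cf g p)\<^sup>2 = 0" if "p \<in> idx" for p
    by (rule nonneg_infsum_le_0D[OF le coeffs_of_sq_summable]) (use that in auto)
  then have "span (case_prod \<psi> ` idx) \<subseteq> {f. inner g f = 0}"
    by (intro span_minimal) (auto simp: subspace_def inner_add_right coeffs_of_eq)
  moreover have "closed {f. inner g f = 0}"
    by (intro closed_Collect_eq continuous_intros)
  ultimately have "closure (span (case_prod \<psi> ` idx)) \<subseteq> {f. inner g f = 0}"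
    by (rule closure_minimal)
  then have "inner g g = 0"
    unfolding dense_span by blast
  then show False using assms by simp
qed

end

section \<open>Gaussian series\<close>

lemma (in prob_space) char_scaled_std_normal:
  assumes "distributed M lborel X std_normal_density"
  shows "char (distr M borel (\<lambda>\<omega>. c * X \<omega>)) t = of_real (exp (- (c * t)\<^sup>2 / 2))"
proof -
  have X: "X \<in> borel_measurable M"
    using assms by (simp add: distributed_def measurable_lborel1)
  have "distr M borel X = distr M lborel X"
    by (rule distr_cong) simp_all
  then have D: "distr M borel X = std_normal_distribution"
    using assms by (simp add: distributed_def)
  have "char (distr M borel (\<lambda>\<omega>. c * X \<omega>)) t = (CLINT \<omega>|M. iexp ((c * t) * X \<omega>))"
    unfolding char_def using X by (subst integral_distr) (auto simp: mult_ac)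
  also have "\<dots> = char (distr M borel X) (c * t)"
    unfolding char_def using X by (subst integral_distr) auto
  finally show ?thesis
    by (simp add: D char_std_normal_distribution)
qed

text \<open>Infinite sums converge along the filter of finite subsets, whereas dominated convergence
  and measurability of limits are about sequences. An enumeration of the index set supplies a
  cofinal sequence of finite subsets.\<close>

lemma ex_finite_exhaustion:
  assumes "countable I"
  obtains F :: "nat \<Rightarrow> 'i set" where "\<And>n. finite (F n)" "\<And>n. F n \<subseteq> I"
    "filterlim F (finite_subsets_at_top I) sequentially"
proof
  define F where "F n = {p \<in> I. to_nat_on I p < n}" for n
  show fin: "finite (F n)" for n
  proof (rule finite_imageD)
    show "finite (to_nat_on I ` F n)"
      by (rule finite_subset[of _ "{..<n}"]) (auto simp: F_def)
    show "inj_on (to_nat_on I) (F n)"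
      using inj_on_to_nat_on[OF assms] by (rule inj_on_subset) (auto simp: F_def)
  qed
  show sub: "F n \<subseteq> I" for n
    by (auto simp: F_def)
  show "filterlim F (finite_subsets_at_top I) sequentially"
    unfolding filterlim_finite_subsets_at_top
  proof (intro allI impI)
    fix J assume J: "finite J \<and> J \<subseteq> I"
    then obtain k where k: "\<And>p. p \<in> J \<Longrightarrow> to_nat_on I p < k"
      by (metis finite_imageI finite_nat_set_iff_bounded imageI)
    show "\<forall>\<^sub>F n in sequentially. finite (F n) \<and> J \<subseteq> F n \<and> F n \<subseteq> I"
      using eventually_ge_at_top[of k]
    proof eventually_elim
      case (elim n)
      then show ?case
        using k J fin sub by (fastforce simp: F_def)
    qed
  qed
qed

text \<open>Independence factorises the characteristic functions of the finite partial sums,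
  dominated convergence passes to the limit, and a law is determined by its characteristic function.
  Convergence is asked for at every point, which white noise with values in \<open>H\<close>
  provides.\<close>

lemma (in prob_space) gaussian_series_distr:
  fixes X :: "'i \<Rightarrow> 'a \<Rightarrow> real" and c :: "'i \<Rightarrow> real"
  assumes I: "countable I"
    and indep: "indep_vars (\<lambda>_. borel) X I"
    and normal: "\<And>p. p \<in> I \<Longrightarrow> distributed M lborel (X p) std_normal_density"
    and conv: "\<And>\<omega>. \<omega> \<in> space M \<Longrightarrow> (\<lambda>p. c p * X p \<omega>) summable_on I"
    and sq: "(\<lambda>p. (c p)\<^sup>2) summable_on I"
  shows "distr M borel (\<lambda>\<omega>. \<Sum>\<^sub>\<infinity>p\<in>I. c p * X p \<omega>) =
      distr std_normal_distribution borel (\<lambda>x. sqrt (\<Sum>\<^sub>\<infinity>p\<in>I. (c p)\<^sup>2) * x)" (is "distr M borel ?Y = ?N")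
proof -
  obtain F where F: "\<And>n. finite (F n)" "\<And>n. F n \<subseteq> I"
    and lim: "filterlim F (finite_subsets_at_top I) sequentially"
    using ex_finite_exhaustion[OF I] by blast
  define Y where "Y n \<omega> = (\<Sum>p\<in>F n. c p * X p \<omega>)" for n \<omega>
  define v where "v = (\<Sum>\<^sub>\<infinity>p\<in>I. (c p)\<^sup>2)"
  have v: "v \<ge> 0" unfolding v_def by (rule infsum_nonneg) simp
  have X: "X p \<in> borel_measurable M" if "p \<in> I" for p
    using normal[OF that] by (simp add: distributed_def measurable_lborel1)
  have Ym: "Y n \<in> borel_measurable M" for n
    unfolding Y_def using F by (intro borel_measurable_sum borel_measurable_times X) auto
  have Ylim: "(\<lambda>n. Y n \<omega>) \<longlonglongrightarrow> ?Y \<omega>" if "\<omega> \<in> space M" for \<omega>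
    unfolding Y_def using has_sum_infsum[OF conv[OF that]] lim
    by (auto simp: has_sum_def intro: filterlim_compose)
  have Y: "?Y \<in> borel_measurable M"
    by (rule borel_measurable_LIMSEQ_real[OF Ylim Ym])
  have charY: "char (distr M borel (Y n)) t = of_real (exp (- (t\<^sup>2 * (\<Sum>p\<in>F n. (c p)\<^sup>2)) / 2))" for n t
  proof -
    have "indep_vars (\<lambda>_. borel) X (F n)"
      using indep F(2) by (rule indep_vars_subset)
    then have "indep_vars (\<lambda>_. borel) (\<lambda>p \<omega>. c p * X p \<omega>) (F n)"
      by (rule indep_vars_compose2[where X = X and Y = "\<lambda>p x. c p * x"]) simp
    then have "char (distr M borel (Y n)) t = (\<Prod>p\<in>F n. char (distr M borel (\<lambda>\<omega>. c p * X p \<omega>)) t)"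
      unfolding Y_def by (rule char_distr_sum)
    also have "\<dots> = (\<Prod>p\<in>F n. of_real (exp (- (c p * t)\<^sup>2 / 2)))"
      using F(2) by (intro prod.cong refl char_scaled_std_normal normal) auto
    also have "\<dots> = of_real (exp (\<Sum>p\<in>F n. - (c p * t)\<^sup>2 / 2))"
      using F(1) by (simp add: exp_sum)
    also have "(\<Sum>p\<in>F n. - (c p * t)\<^sup>2 / 2) = - (t\<^sup>2 * (\<Sum>p\<in>F n. (c p)\<^sup>2)) / 2"
      by (simp add: sum_distrib_left sum_divide_distrib sum_negf power_mult_distrib mult_ac)
    finally show ?thesis .
  qed
  have "char (distr M borel ?Y) = char ?N"
  proof
    fix t
    have "(\<lambda>n. char (distr M borel (Y n)) t) \<longlonglongrightarrow> char (distr M borel ?Y) t"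
    proof -
      have "(\<lambda>n. CLINT \<omega>|M. iexp (t * Y n \<omega>)) \<longlonglongrightarrow> (CLINT \<omega>|M. iexp (t * ?Y \<omega>))"
      proof (rule integral_dominated_convergence[where w = "\<lambda>_. 1"])
        show "AE \<omega> in M. (\<lambda>n. iexp (t * Y n \<omega>)) \<longlonglongrightarrow> iexp (t * ?Y \<omega>)"
          using Ylim by (auto intro!: tendsto_intros)
      qed (use Y Ym in auto)
      then show ?thesis
        unfolding char_def using Y Ym by (simp add: integral_distr)
    qed
    moreover have "(\<lambda>n. char (distr M borel (Y n)) t) \<longlonglongrightarrow> of_real (exp (- (t\<^sup>2 * v) / 2))"
    proof -
      have "((\<lambda>n. \<Sum>p\<in>F n. (c p)\<^sup>2) \<longlonglongrightarrow> v)"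
        unfolding v_def using has_sum_infsum[OF sq] lim by (auto simp: has_sum_def intro: filterlim_compose)
      then show ?thesis
        unfolding charY by (auto intro!: tendsto_intros)
    qed
    ultimately have "char (distr M borel ?Y) t = of_real (exp (- (t\<^sup>2 * v) / 2))"
      by (rule LIMSEQ_unique)
    moreover have "char ?N t = char std_normal_distribution (t * sqrt v)"
      unfolding char_def v_def by (subst integral_distr) (auto simp: mult_ac)
    ultimately show "char (distr M borel ?Y) t = char ?N t"
      using v by (simp add: char_std_normal_distribution power_mult_distrib)
  qed
  moreover have "real_distribution (distr M borel ?Y)"
    using Y by (rule real_distribution_distr)
  moreover have "real_distribution ?N"
  proof -
    interpret N: real_distribution std_normal_distribution by (rule real_dist_normal_dist)
    show ?thesis by (rule N.real_distribution_distr) simp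
  qed
  ultimately show ?thesis
    by (intro Levy_uniqueness)
qed

section \<open>Continuity of normal distribution functions\<close>

lemma std_normal_interval_le:
  assumes "x \<le> y"
  shows "measure std_normal_distribution {x<..y} \<le> y - x"
proof -
  have "std_normal_density z \<le> 1" for z
  proof -
    \<comment> \<open>The crude bound 1 for the density is enough, since only some Lipschitz
      constant is wanted.\<close>
    have "1 \<le> sqrt (2 * pi)" using pi_ge_two by (simp add: real_le_rsqrt)
    then have "1 / sqrt (2 * pi) \<le> 1" by simp
    moreover have "exp (- z\<^sup>2 / 2) \<le> 1" by simp
    ultimately have "1 / sqrt (2 * pi) * exp (- z\<^sup>2 / 2) \<le> 1 * 1"
      by (intro mult_mono) auto
    then show ?thesis by (simp add: std_normal_density_def)
  qed
  then have "emeasure std_normal_distribution {x<..y} \<le> (\<integral>\<^sup>+ z. 1 * indicator {x<..y} z \<partial>lborel)"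
    by (subst emeasure_density) (auto intro!: nn_integral_mono mult_right_mono ennreal_leI simp flip: ennreal_1)
  also have "\<dots> = ennreal (y - x)"
    using assms by simp
  finally have "emeasure std_normal_distribution {x<..y} \<le> ennreal (y - x)" .
  then show ?thesis
    using assms by (simp add: measure_def enn2real_leI)
qed

text \<open>This pays for both shifts of the level: the width of the ramps and the linearisation
  error.\<close>

lemma cdf_scaled_std_normal_Lipschitz:
  assumes "0 < \<sigma>" "x \<le> y"
  defines "N \<equiv> distr std_normal_distribution borel (\<lambda>x. \<sigma> * x)"
  shows "cdf N y - cdf N x \<le> (y - x) / \<sigma>"
proof -
  interpret std: real_distribution std_normal_distribution by (rule real_dist_normal_dist)
  interpret N: real_distribution N
    unfolding N_def by (rule std.real_distribution_distr) simp
  have "cdf N y - cdf N x = measure N {x<..y}"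
    using assms(2) by (cases "x = y") (auto simp: N.cdf_diff_eq)
  also have "\<dots> = measure std_normal_distribution ((\<lambda>x. \<sigma> * x) -` {x<..y})"
    unfolding N_def by (subst measure_distr) auto
  also have "(\<lambda>x. \<sigma> * x) -` {x<..y} = {x / \<sigma><..y / \<sigma>}"
    using assms(1) by (auto simp: field_simps)
  also have "measure std_normal_distribution \<dots> \<le> y / \<sigma> - x / \<sigma>"
    using assms by (intro std_normal_interval_le divide_right_mono) auto
  finally show ?thesis by (simp add: diff_divide_distrib)
qed

lemma continuous_cdf_scaled_std_normal:
  assumes "0 < \<sigma>"
  shows "continuous_on UNIV (cdf (distr std_normal_distribution borel (\<lambda>x. \<sigma> * x)))" (is "continuous_on _ (cdf ?N)")
proof -
  interpret std: real_distribution std_normal_distribution by (rule real_dist_normal_dist)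
  interpret N: real_distribution ?N
    by (rule std.real_distribution_distr) simp
  have le: "\<bar>cdf ?N x - cdf ?N y\<bar> \<le> inverse \<sigma> * \<bar>x - y\<bar>" for x y
    using cdf_scaled_std_normal_Lipschitz[OF assms, of x y] cdf_scaled_std_normal_Lipschitz[OF assms, of y x]
      N.cdf_nondecreasing[of x y] N.cdf_nondecreasing[of y x] assms
    by (cases "x \<le> y") (auto simp: abs_if divide_inverse mult.commute)
  have "(inverse \<sigma>)-lipschitz_on UNIV (cdf ?N)"
    by (rule lipschitz_onI) (use le assms in \<open>auto simp: dist_real_def\<close>)
  then show ?thesis
    by (rule lipschitz_on_continuous_on)
qed

section \<open>Coverage of random intervals\<close>

text \<open>The intermediate value theorem between the limits 0 and 1. It supplies exact
  deterministic cut points without a quantile function.\<close>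

lemma (in real_distribution) cdf_attains:
  assumes "continuous_on UNIV (cdf M)" "0 < u" "u < 1"
  obtains x where "cdf M x = u"
proof -
  have "\<forall>\<^sub>F x in at_bot. cdf M x < u"
    using cdf_lim_at_bot assms(2) by (rule order_tendstoD)
  then obtain x where x: "cdf M x < u"
    using eventually_happens'[of at_bot] by (auto simp: eventually_at_bot_linorder)
  have "\<forall>\<^sub>F x in at_top. u < cdf M x"
    using cdf_lim_at_top_prob assms(3) by (rule order_tendstoD)
  then obtain y where y: "u < cdf M y"
    by (auto simp: eventually_at_top_linorder)
  have "x \<le> y"
    using x y cdf_nondecreasing[of y x] by force
  moreover have "continuous_on {x..y} (cdf M)"
    using assms(1) continuous_on_subset by blast
  ultimately show ?thesis
    using IVT'[of "cdf M" x u y] x y that by auto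
qed

lemma tendsto_0_in_prob_measure:
  assumes "tendsto_0_in_prob P Y" "0 < \<epsilon>"
    and P: "\<And>n. n \<ge> 1 \<Longrightarrow> prob_space (P n)" "\<And>n. n \<ge> 1 \<Longrightarrow> Y n \<in> borel_measurable (P n)"
  shows "(\<lambda>n. measure (P n) {x \<in> space (P n). \<bar>Y n x\<bar> > \<epsilon>}) \<longlonglongrightarrow> 0"
proof -
  have "(\<lambda>n. enn2real (outer_measure_of (P n) {x \<in> space (P n). \<bar>Y n x\<bar> > \<epsilon>})) \<longlonglongrightarrow> enn2real 0"
    using assms(1,2) by (intro tendsto_enn2real) (auto simp: tendsto_0_in_prob_def)
  moreover have "\<forall>\<^sub>F n in sequentially.
      enn2real (outer_measure_of (P n) {x \<in> space (P n). \<bar>Y n x\<bar> > \<epsilon>}) =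
      measure (P n) {x \<in> space (P n). \<bar>Y n x\<bar> > \<epsilon>}"
    using eventually_ge_at_top[of 1]
  proof eventually_elim
    case (elim n)
    have [measurable]: "Y n \<in> borel_measurable (P n)"
      using P(2)[OF elim] .
    show ?case
      by (subst outer_measure_of_eq) (auto simp: measure_def)
  qed
  ultimately show ?thesis
    by (auto intro: Lim_transform_eventually)
qed

text \<open>Only the \<open>N\<close>-levels of the endpoints converge. Off two events of small
  probability each endpoint lies between two deterministic cut points, so the random interval is
  squeezed between two deterministic ones, whose probabilities are known because \<open>G n\<close>
  has law \<open>N\<close>. The endpoints may depend on \<open>G n\<close> in any way.\<close>

lemma interval_coverage:
  fixes P :: "nat \<Rightarrow> 'x measure" and G m v :: "nat \<Rightarrow> 'x \<Rightarrow> real"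
  assumes N: "real_distribution N" "continuous_on UNIV (cdf N)"
    and P: "\<And>n. n \<ge> 1 \<Longrightarrow> prob_space (P n)"
    and G: "\<And>n. n \<ge> 1 \<Longrightarrow> G n \<in> borel_measurable (P n)"
      "\<And>n. n \<ge> 1 \<Longrightarrow> distr (P n) borel (G n) = N"
    and m: "\<And>n. n \<ge> 1 \<Longrightarrow> m n \<in> borel_measurable (P n)"
      "tendsto_0_in_prob P (\<lambda>n x. cdf N (m n x) - q)"
    and v: "\<And>n. n \<ge> 1 \<Longrightarrow> v n \<in> borel_measurable (P n)"
      "tendsto_0_in_prob P (\<lambda>n x. cdf N (v n x) - q')"
    and q: "0 < q" "q < q'" "q' < 1"
  shows "(\<lambda>n. measure (P n) {x \<in> space (P n). m n x < G n x \<and> G n x \<le> v n x}) \<longlonglongrightarrow> q' - q"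
proof (rule LIMSEQ_I)
  fix e :: real assume "0 < e"
  interpret N: real_distribution N by fact
  have cdf_m [measurable]: "cdf N \<in> borel_measurable borel"
    using N(2) by (rule borel_measurable_continuous_onI)
  \<comment> \<open>The total error is 4 \<epsilon>: 2 \<epsilon> from the cut points and \<epsilon>
    from each exceptional event, so \<epsilon> \<le> e / 5 suffices. The entries with
    \<open>q\<close> and \<open>q'\<close> keep the four cut levels inside the unit interval and put
    \<open>q + \<epsilon>\<close> below \<open>q' - \<epsilon>\<close>.\<close>
  define \<epsilon> where "\<epsilon> = Min {e / 5, q / 2, (1 - q') / 2, (q' - q) / 4}"
  have \<epsilon>: "0 < \<epsilon>" "\<epsilon> \<le> e / 5" "\<epsilon> \<le> q / 2" "\<epsilon> \<le> (1 - q') / 2" "\<epsilon> \<le> (q' - q) / 4"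
  proof -
    show "0 < \<epsilon>"
      using q \<open>0 < e\<close> unfolding \<epsilon>_def by (subst Min_gr_iff) auto
  qed (simp_all only: \<epsilon>_def, (rule Min_le, simp, blast)+)
  obtain a1 where a1: "cdf N a1 = q - \<epsilon>"
    by (rule N.cdf_attains[OF N(2), of "q - \<epsilon>"]) (use \<epsilon> q in auto)
  obtain a2 where a2: "cdf N a2 = q + \<epsilon>"
    by (rule N.cdf_attains[OF N(2), of "q + \<epsilon>"]) (use \<epsilon> q in auto)
  obtain b1 where b1: "cdf N b1 = q' - \<epsilon>"
    by (rule N.cdf_attains[OF N(2), of "q' - \<epsilon>"]) (use \<epsilon> q in auto)
  obtain b2 where b2: "cdf N b2 = q' + \<epsilon>"
    by (rule N.cdf_attains[OF N(2), of "q' + \<epsilon>"]) (use \<epsilon> q in auto)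
  have lt: "x < y" if "cdf N x < cdf N y" for x y
    using that N.cdf_nondecreasing[of y x] by force
  have ab: "a1 < b2" "a2 < b1"
    by (rule lt, use a1 b2 q \<epsilon> in simp) (rule lt, use a2 b1 q \<epsilon> in simp)
  \<comment> \<open>The tolerance is half of \<epsilon> so that the levels compare strictly with the
    cut levels: for a merely monotone distribution function only a strict inequality of values
    orders the arguments.\<close>
  let ?Bm = "\<lambda>n. {x \<in> space (P n). \<bar>cdf N (m n x) - q\<bar> > \<epsilon> / 2}"
  let ?Bv = "\<lambda>n. {x \<in> space (P n). \<bar>cdf N (v n x) - q'\<bar> > \<epsilon> / 2}"
  let ?E = "\<lambda>n. {x \<in> space (P n). m n x < G n x \<and> G n x \<le> v n x}"
  have "(\<lambda>n. measure (P n) (?Bm n)) \<longlonglongrightarrow> 0"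
  proof (rule tendsto_0_in_prob_measure[OF m(2)])
    show "(\<lambda>x. cdf N (m n x) - q) \<in> borel_measurable (P n)" if "n \<ge> 1" for n
      using m(1)[OF that] by measurable
  qed (use \<epsilon> P in auto)
  then have Bm: "\<forall>\<^sub>F n in sequentially. measure (P n) (?Bm n) < \<epsilon>"
    using \<epsilon>(1) by (rule order_tendstoD)
  have "(\<lambda>n. measure (P n) (?Bv n)) \<longlonglongrightarrow> 0"
  proof (rule tendsto_0_in_prob_measure[OF v(2)])
    show "(\<lambda>x. cdf N (v n x) - q') \<in> borel_measurable (P n)" if "n \<ge> 1" for n
      using v(1)[OF that] by measurable
  qed (use \<epsilon> P in auto)
  then have Bv: "\<forall>\<^sub>F n in sequentially. measure (P n) (?Bv n) < \<epsilon>"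
    using \<epsilon>(1) by (rule order_tendstoD)
  have "\<forall>\<^sub>F n in sequentially. norm (measure (P n) (?E n) - (q' - q)) < e"
    using Bm Bv eventually_ge_at_top[of 1]
  proof eventually_elim
    case (elim n)
    interpret P: prob_space "P n" by (rule P) fact
    have [measurable]: "m n \<in> borel_measurable (P n)" "v n \<in> borel_measurable (P n)"
        "G n \<in> borel_measurable (P n)"
      using m(1) v(1) G(1) elim by auto
    have *: "P.prob {x \<in> space (P n). a < G n x \<and> G n x \<le> b} = cdf N b - cdf N a" if "a < b" for a b
    proof -
      have "cdf N b - cdf N a = measure (distr (P n) borel (G n)) {a<..b}"
        using N.cdf_diff_eq[OF that] G(2) elim by simp
      also have "\<dots> = P.prob {x \<in> space (P n). a < G n x \<and> G n x \<le> b}"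
        by (subst measure_distr) (auto intro!: arg_cong[where f = P.prob])
      finally show ?thesis by simp
    qed
    have mem: "a1 < m n x \<and> m n x < a2" if "x \<in> space (P n) - ?Bm n" for x
    proof -
      have "\<bar>cdf N (m n x) - q\<bar> \<le> \<epsilon> / 2"
        using that by (auto simp: not_less)
      then have "cdf N a1 < cdf N (m n x)" "cdf N (m n x) < cdf N a2"
        using a1 a2 \<epsilon>(1) by linarith+
      then show ?thesis
        using lt by blast
    qed
    have mem': "b1 < v n x \<and> v n x < b2" if "x \<in> space (P n) - ?Bv n" for x
    proof -
      have "\<bar>cdf N (v n x) - q'\<bar> \<le> \<epsilon> / 2"
        using that by (auto simp: not_less)
      then have "cdf N b1 < cdf N (v n x)" "cdf N (v n x) < cdf N b2"
        using b1 b2 \<epsilon>(1) by linarith+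
      then show ?thesis
        using lt by blast
    qed
    have "P.prob (?E n) \<le> P.prob ({x \<in> space (P n). a1 < G n x \<and> G n x \<le> b2} \<union> (?Bm n \<union> ?Bv n))"
    proof (rule P.finite_measure_mono)
      show "?E n \<subseteq> {x \<in> space (P n). a1 < G n x \<and> G n x \<le> b2} \<union> (?Bm n \<union> ?Bv n)"
        (is "?L \<subseteq> ?R")
      proof
        fix x assume x: "x \<in> ?L"
        show "x \<in> ?R"
        proof (cases "x \<in> ?Bm n \<union> ?Bv n")
          case True
          then show ?thesis by blast
        next
          case False
          then have "x \<in> space (P n) - ?Bm n" "x \<in> space (P n) - ?Bv n"
            using x by blast+
          from mem[OF this(1)] mem'[OF this(2)] x show ?thesis by simp
        qed
      qed
    qed measurable
    also have "\<dots> \<le> P.prob {x \<in> space (P n). a1 < G n x \<and> G n x \<le> b2} + (P.prob (?Bm n) + P.prob (?Bv n))"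
      by (intro order_trans[OF measure_Un_le] add_left_mono measure_Un_le)
        measurable
    finally have upper: "P.prob (?E n) \<le> q' - q + 2 * \<epsilon> + (P.prob (?Bm n) + P.prob (?Bv n))"
      using *[OF ab(1)] a1 b2 by simp
    have "P.prob {x \<in> space (P n). a2 < G n x \<and> G n x \<le> b1} \<le> P.prob (?E n \<union> (?Bm n \<union> ?Bv n))"
    proof (rule P.finite_measure_mono)
      show "{x \<in> space (P n). a2 < G n x \<and> G n x \<le> b1} \<subseteq> ?E n \<union> (?Bm n \<union> ?Bv n)"
        (is "?L \<subseteq> ?R")
      proof
        fix x assume x: "x \<in> ?L"
        show "x \<in> ?R"
        proof (cases "x \<in> ?Bm n \<union> ?Bv n")
          case True
          then show ?thesis by blast
        next
          case False
          then have "x \<in> space (P n) - ?Bm n" "x \<in> space (P n) - ?Bv n"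
            using x by blast+
          from mem[OF this(1)] mem'[OF this(2)] x show ?thesis by simp
        qed
      qed
    qed measurable
    also have "\<dots> \<le> P.prob (?E n) + (P.prob (?Bm n) + P.prob (?Bv n))"
      by (intro order_trans[OF measure_Un_le] add_left_mono measure_Un_le)
        measurable
    finally have "q' - q - 2 * \<epsilon> \<le> P.prob (?E n) + (P.prob (?Bm n) + P.prob (?Bv n))"
      using *[OF ab(2)] a2 b1 by simp
    then show ?case
      using upper elim(1,2) \<epsilon>(1,2) \<open>0 < e\<close> by (auto simp: abs_if)
  qed
  then show "\<exists>k. \<forall>n\<ge>k. norm (measure (P n) (?E n) - (q' - q)) < e"
    by (simp add: eventually_sequentially)
qed

section \<open>The bounded Lipschitz distance and half spaces\<close>

context noise_space
begin

abbreviation BL :: "coeffs measure \<Rightarrow> coeffs measure \<Rightarrow> real" where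
  "BL \<equiv> BL_metric H (H_dist L Z a \<delta>)"

text \<open>A supremum of reals dominates its members only if the family is bounded above; here
  every integral is at most 1 in modulus.\<close>

lemma BL_ball_diff_le:
  assumes A: "prob_space A" "space A = H" and B: "prob_space B" "space B = H"
    and u: "u \<in> BL_ball H (H_dist L Z a \<delta>)"
  shows "\<bar>(\<integral>x. u x \<partial>A) - (\<integral>x. u x \<partial>B)\<bar> \<le> BL A B"
proof -
  have bound: "\<bar>\<integral>x. u x \<partial>Q\<bar> \<le> 1" if "u \<in> BL_ball H (H_dist L Z a \<delta>)" "prob_space Q" "space Q = H" for u Q
  proof -
    interpret Q: prob_space Q by fact
    have le: "\<bar>u x\<bar> \<le> 1" if "x \<in> space Q" for x
      using \<open>u \<in> _\<close> that \<open>space Q = H\<close> by (fastforce simp: BL_ball_def)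
    show ?thesis
    \<comment> \<open>Only the space of \<open>Q\<close> is known, so \<open>u\<close> need not be
      measurable for it. In that case the integral has the default value 0, which satisfies the
      bound too.\<close>
    proof (cases "integrable Q u")
      case True
      have "\<bar>\<integral>x. u x \<partial>Q\<bar> \<le> (\<integral>x. \<bar>u x\<bar> \<partial>Q)"
        using integral_norm_bound[of Q u] by simp
      also have "\<dots> \<le> (\<integral>x. 1 \<partial>Q)"
        using True le by (intro integral_mono) auto
      finally show ?thesis by (simp add: Q.prob_space)
    qed (simp add: not_integrable_integral_eq)
  qed
  have "bdd_above ((\<lambda>u. \<bar>(\<integral>x. u x \<partial>A) - (\<integral>x. u x \<partial>B)\<bar>) ` BL_ball H (H_dist L Z a \<delta>))"
  proof (rule bdd_aboveI2)
    fix u assume "u \<in> BL_ball H (H_dist L Z a \<delta>)"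
    then show "\<bar>(\<integral>x. u x \<partial>A) - (\<integral>x. u x \<partial>B)\<bar> \<le> 2"
      using bound[OF _ A] bound[OF _ B] by fastforce
  qed
  then show ?thesis
    unfolding BL_metric_def using u by (rule cSUP_upper2) simp
qed

lemma rescale_coeffs_of_measurable:
  assumes "x \<in> H"
  shows "(\<lambda>f. rescale n x (cf f)) \<in> measurable borel HB"
proof -
  have "(\<lambda>y. rescale n x y) = (\<lambda>y p. - (sqrt n * x p) + sqrt n * y p)"
    by (auto simp: rescale_def algebra_simps)
  moreover have "(\<lambda>y p. - (sqrt n * x p) + sqrt n * y p) \<in> measurable HB HB"
    using H_scale[OF assms, of "- sqrt n"] by (intro affine_measurable_HB) simp
  ultimately show ?thesis
    using measurable_compose[OF coeffs_of_measurable] by simp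
qed

end

context dual_form
begin

text \<open>The ramp functions \<open>y \<mapsto> max 0 (min 1 ((t + \<eta> - pairing c y) / \<eta>))\<close> lie between the indicators
  of two half spaces at distance \<open>\<eta>\<close> and are Lipschitz, uniformly in the level \<open>t\<close>.\<close>

lemma half_space_measure_le:
  assumes A: "prob_space A" "sets A = sets HB" and B: "prob_space B" "sets B = sets HB"
    and "0 < \<eta>"
  shows "measure A {y \<in> H. pairing c y \<le> t} \<le> measure B {y \<in> H. pairing c y \<le> t + \<eta>} + (1 + dnorm / \<eta>) * BL A B"
    and "measure B {y \<in> H. pairing c y \<le> t} \<le> measure A {y \<in> H. pairing c y \<le> t + \<eta>} + (1 + dnorm / \<eta>) * BL A B"
proof -
  interpret A: prob_space A by fact
  interpret B: prob_space B by fact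
  have sp: "space A = H" "space B = H"
    using sets_eq_imp_space_eq[OF A(2)] sets_eq_imp_space_eq[OF B(2)] space_HB by auto
  define u where "u y = max 0 (min 1 ((t + \<eta> - pairing c y) / \<eta>))" for y
  \<comment> \<open>The sup-norm bound 1 of the ramp plus its Lipschitz constant
    \<open>dnorm / \<eta>\<close>; dividing by \<open>K\<close> puts the ramp into the unit
    ball.\<close>
  define K where "K = 1 + dnorm / \<eta>"
  have K: "K \<ge> 1"
    using dnorm_nonneg \<open>0 < \<eta>\<close> by (simp add: K_def)
  have u01: "0 \<le> u y" "u y \<le> 1" for y
    by (auto simp: u_def)
  have pm: "pairing c \<in> borel_measurable A" "pairing c \<in> borel_measurable B"
    using pairing_measurable measurable_cong_sets[OF A(2) refl] measurable_cong_sets[OF B(2) refl] by auto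
  have um: "u \<in> borel_measurable A" "u \<in> borel_measurable B"
    unfolding u_def using pm by measurable
  have int: "integrable A u" "integrable B u"
    using um u01 by (auto intro!: A.integrable_const_bound[where B = 1] B.integrable_const_bound[where B = 1])
  have "(\<lambda>y. u y / K) \<in> BL_ball H (H_dist L Z a \<delta>)"
    unfolding BL_ball_def
  proof (intro CollectI exI conjI ballI)
    show "0 \<le> 1 / K" "0 \<le> (dnorm / \<eta>) / K"
      using K dnorm_nonneg \<open>0 < \<eta>\<close> by auto
    have "1 / K + (dnorm / \<eta>) / K = (1 + dnorm / \<eta>) / K"
      by (simp add: add_divide_distrib)
    then show "1 / K + (dnorm / \<eta>) / K \<le> 1"
      using K by (simp add: K_def)
    show "\<bar>u y / K\<bar> \<le> 1 / K" for y
      using u01[of y] K by (simp add: divide_right_mono)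
    fix x y assume xy: "x \<in> H" "y \<in> H"
    have clamp: "\<bar>max 0 (min 1 r) - max 0 (min 1 r')\<bar> \<le> \<bar>r - r'\<bar>" for r r' :: real
      by (simp add: max_def min_def abs_if)
    have "\<bar>u x - u y\<bar> \<le> \<bar>(t + \<eta> - pairing c x) / \<eta> - (t + \<eta> - pairing c y) / \<eta>\<bar>"
      unfolding u_def by (rule clamp)
    also have "\<dots> = \<bar>pairing c x - pairing c y\<bar> / \<eta>"
    proof -
      have "(t + \<eta> - pairing c x) / \<eta> - (t + \<eta> - pairing c y) / \<eta> = - ((pairing c x - pairing c y) / \<eta>)"
        by (simp add: diff_divide_distrib)
      then show ?thesis using \<open>0 < \<eta>\<close> by simp
    qed
    also have "\<dots> \<le> dnorm * H_dist L Z a \<delta> x y / \<eta>"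
      using pairing_Lipschitz[OF xy] \<open>0 < \<eta>\<close> by (intro divide_right_mono) (auto simp: H_dist_def)
    finally have "\<bar>u x - u y\<bar> / K \<le> (dnorm * H_dist L Z a \<delta> x y / \<eta>) / K"
      using K by (intro divide_right_mono) auto
    moreover have "\<bar>u x / K - u y / K\<bar> = \<bar>u x - u y\<bar> / K"
      using K by (simp add: diff_divide_distrib[symmetric])
    ultimately show "\<bar>u x / K - u y / K\<bar> \<le> dnorm / \<eta> / K * H_dist L Z a \<delta> x y"
      by simp
  qed
  then have "\<bar>(\<integral>y. u y / K \<partial>A) - (\<integral>y. u y / K \<partial>B)\<bar> \<le> BL A B"
    by (intro BL_ball_diff_le A B sp)
  then have "\<bar>(\<integral>y. u y \<partial>A) - (\<integral>y. u y \<partial>B)\<bar> / K \<le> BL A B"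
    using K by (simp add: diff_divide_distrib[symmetric])
  then have diff: "\<bar>(\<integral>y. u y \<partial>A) - (\<integral>y. u y \<partial>B)\<bar> \<le> K * BL A B"
    using K by (simp add: divide_le_eq mult.commute)
  have half: "measure Q {y \<in> H. pairing c y \<le> t} \<le> (\<integral>y. u y \<partial>Q)"
    "(\<integral>y. u y \<partial>Q) \<le> measure Q {y \<in> H. pairing c y \<le> t + \<eta>}"
    if "prob_space Q" "space Q = H" "pairing c \<in> borel_measurable Q" "integrable Q u" for Q
  proof -
    interpret Q: prob_space Q by fact
    have m: "{y \<in> H. pairing c y \<le> b} \<in> sets Q" for b
      using borel_measurable_le[OF that(3), of "\<lambda>_. b"] that(2) by simp
    have i: "integrable Q (indicat_real {y \<in> H. pairing c y \<le> b})" for b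
      using m by (intro integrable_real_indicator) (auto simp: Q.emeasure_eq_measure)
    have "(\<integral>y. indicat_real {y \<in> H. pairing c y \<le> t} y \<partial>Q) \<le> (\<integral>y. u y \<partial>Q)"
      using \<open>0 < \<eta>\<close> by (intro integral_mono i that) (auto simp: u_def indicator_def min_def max_def field_simps)
    then show "measure Q {y \<in> H. pairing c y \<le> t} \<le> (\<integral>y. u y \<partial>Q)"
      using m by simp
    have "(\<integral>y. u y \<partial>Q) \<le> (\<integral>y. indicat_real {y \<in> H. pairing c y \<le> t + \<eta>} y \<partial>Q)"
      using \<open>0 < \<eta>\<close> that(2) by (intro integral_mono i that) (auto simp: u_def indicator_def min_def max_def field_simps)
    then show "(\<integral>y. u y \<partial>Q) \<le> measure Q {y \<in> H. pairing c y \<le> t + \<eta>}"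
      using m by simp
  qed
  note hA = half[OF A(1) sp(1) pm(1) int(1)] and hB = half[OF B(1) sp(2) pm(2) int(2)]
  show "measure A {y \<in> H. pairing c y \<le> t} \<le> measure B {y \<in> H. pairing c y \<le> t + \<eta>} + (1 + dnorm / \<eta>) * BL A B"
    using hA(1) hB(2) diff unfolding K_def by linarith
  show "measure B {y \<in> H. pairing c y \<le> t} \<le> measure A {y \<in> H. pairing c y \<le> t + \<eta>} + (1 + dnorm / \<eta>) * BL A B"
    using hB(1) hA(2) diff unfolding K_def by linarith
qed

end

text \<open>Here \<open>m\<close> is the level \<open>t\<close> after centring at the efficient estimator
  \<open>\<Psi> f0 + pairing c x - pairing c (cf f0)\<close> and rescaling; \<open>\<rho>\<close> bounds the rescaled linearisation error
  off the set \<open>Bd\<close>.\<close>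

lemma (in noise_space) posterior_quantile_bound:
  fixes K :: "L2 measure" and N :: "real measure" and R :: "coeffs measure" and t :: real
  assumes dual_form: "dual_form S L Z a \<psi> \<delta> (cf g)"
    and K: "prob_space K" "sets K = sets borel" and x: "x \<in> H" and n: "n \<ge> 1"
    and \<Psi>: "\<Psi> \<in> borel_measurable borel"
    and Bd: "Bd \<in> sets borel" "\<And>f. f \<notin> Bd \<Longrightarrow> sqrt n * \<bar>\<Psi> f - \<Psi> f0 - inner (f - f0) g\<bar> \<le> \<rho>"
    and R: "prob_space R" "sets R = sets HB" "\<And>t. measure R {y \<in> H. pairing (cf g) y \<le> t} = cdf N t"
    and N: "\<And>t t'. t \<le> t' \<Longrightarrow> cdf N t' - cdf N t \<le> l * (t' - t)"
    and \<eta>: "0 < \<eta>" and \<rho>: "0 \<le> \<rho>"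
  defines "m \<equiv> sqrt n * (t - \<Psi> f0) - pairing (cf g) (\<lambda>p. sqrt n * (x p - cf f0 p))"
  shows "\<bar>cdf N m - measure K {f. \<Psi> f \<le> t}\<bar> \<le> l * (\<rho> + \<eta>)
    + (1 + dual_form.dnorm L Z a \<delta> (cf g) / \<eta>) * BL (distr K HB (\<lambda>f. rescale n x (cf f))) R + measure K Bd"
proof -
  interpret dual_form S L Z a \<psi> \<delta> "cf g" by fact
  interpret K: prob_space K by fact
  let ?T = "pairing (cf g)"
  let ?Q = "distr K HB (\<lambda>f. rescale n x (cf f))"
  have rm: "(\<lambda>f. rescale n x (cf f)) \<in> measurable K HB"
    using rescale_coeffs_of_measurable[OF x] measurable_cong_sets[OF K(2) refl] by blast
  have Q: "prob_space ?Q" "sets ?Q = sets HB"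
    using K.prob_space_distr[OF rm] by auto
  \<comment> \<open>Centring at the observation instead of \<open>f0\<close> subtracts the noise
    contained in the observation; the remaining part is the linear term of the expansion.\<close>
  have T: "?T (rescale n x (cf f)) = sqrt n * (inner (f - f0) g) - ?T (\<lambda>p. sqrt n * (x p - cf f0 p))" for f
  proof -
    have "rescale n x (cf f) = (\<lambda>p. sqrt n * cf (f - f0) p + - 1 * (sqrt n * (x p - cf f0 p)))"
      by (auto simp: rescale_def coeffs_of_diff algebra_simps)
    moreover have "(\<lambda>p. sqrt n * (x p - cf f0 p)) \<in> H"
      by (intro H_scale H_diff x coeffs_of_in_H)
    ultimately show ?thesis
      using pairing_lincomb[OF coeffs_of_in_H, of _ "sqrt n" "f - f0" "- 1"] pairing_coeffs_of[OF dual_form]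
      by simp
  qed
  have [measurable]: "{f. \<Psi> f \<le> t} \<in> sets K" "Bd \<in> sets K"
    using \<Psi> Bd(1) K(2) by simp_all
  have Qeq: "measure ?Q {y \<in> H. ?T y \<le> b} = measure K {f. ?T (rescale n x (cf f)) \<le> b}"
    and mb: "{f. ?T (rescale n x (cf f)) \<le> b} \<in> sets K" for b
  proof -
    have "{y \<in> space HB. ?T y \<le> b} \<in> sets HB"
      using pairing_measurable by measurable
    then have h: "{y \<in> H. ?T y \<le> b} \<in> sets HB"
      by (simp add: space_HB)
    have spK: "space K = UNIV"
      using sets_eq_imp_space_eq[OF K(2)] by simp
    have "rescale n x (cf f) \<in> H" for f
      using measurable_space[OF rm, of f] spK by (simp add: space_HB)
    then have eq: "(\<lambda>f. rescale n x (cf f)) -` {y \<in> H. ?T y \<le> b} \<inter> space K = {f. ?T (rescale n x (cf f)) \<le> b}"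
      using spK by auto
    show "measure ?Q {y \<in> H. ?T y \<le> b} = measure K {f. ?T (rescale n x (cf f)) \<le> b}"
      using measure_distr[OF rm h] eq by simp
    show "{f. ?T (rescale n x (cf f)) \<le> b} \<in> sets K"
      using measurable_sets[OF rm h] eq by simp
  qed
  \<comment> \<open>The level \<open>m\<close> contains the same noise term as \<open>T\<close>, so
    the two cancel and only the scaled remainder of the expansion survives.\<close>
  have key: "\<bar>(sqrt n * (\<Psi> f - t) + m) - ?T (rescale n x (cf f))\<bar> \<le> \<rho>" if "f \<notin> Bd" for f
  proof -
    have "(sqrt n * (\<Psi> f - t) + m) - ?T (rescale n x (cf f)) = sqrt n * (\<Psi> f - \<Psi> f0 - inner (f - f0) g)"
      unfolding m_def T by (simp add: algebra_simps)
    then show ?thesis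
      using Bd(2)[OF that] by (simp add: abs_mult)
  qed
  have sgn: "\<Psi> f \<le> t \<longleftrightarrow> sqrt n * (\<Psi> f - t) \<le> 0" for f
    using n by (simp add: mult_le_0_iff)
  have "measure K {f. \<Psi> f \<le> t} \<le> measure K ({f. ?T (rescale n x (cf f)) \<le> m + \<rho>} \<union> Bd)"
  proof (rule K.finite_measure_mono)
    show "{f. \<Psi> f \<le> t} \<subseteq> {f. ?T (rescale n x (cf f)) \<le> m + \<rho>} \<union> Bd"
    proof
      fix f assume "f \<in> {f. \<Psi> f \<le> t}"
      then show "f \<in> {f. ?T (rescale n x (cf f)) \<le> m + \<rho>} \<union> Bd"
        using key[of f] sgn[of f] by (cases "f \<in> Bd") auto
    qed
  qed (use mb in auto)
  also have "\<dots> \<le> measure ?Q {y \<in> H. ?T y \<le> m + \<rho>} + measure K Bd"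
    using mb by (subst Qeq) (auto intro: measure_Un_le)
  also have "measure ?Q {y \<in> H. ?T y \<le> m + \<rho>} \<le> cdf N (m + \<rho> + \<eta>) + (1 + dnorm / \<eta>) * BL ?Q R"
    using half_space_measure_le(1)[OF Q R(1,2) \<eta>, of "m + \<rho>"] R(3) by simp
  finally have upper: "measure K {f. \<Psi> f \<le> t} \<le> cdf N m + l * (\<rho> + \<eta>) + (1 + dnorm / \<eta>) * BL ?Q R + measure K Bd"
    using N[of m "m + \<rho> + \<eta>"] \<rho> \<eta> by simp
  \<comment> \<open>For the other direction the start is \<rho> + \<eta> below \<open>m\<close>: the
    ramp uses up \<eta>, the linearisation error uses up \<rho>, and the condition
    \<open>\<Psi> f \<le> t\<close> is reached.\<close>
  have "cdf N m \<le> cdf N (m - \<rho> - \<eta>) + l * (\<rho> + \<eta>)"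
    using N[of "m - \<rho> - \<eta>" m] \<rho> \<eta> by simp
  also have "cdf N (m - \<rho> - \<eta>) \<le> measure ?Q {y \<in> H. ?T y \<le> m - \<rho>} + (1 + dnorm / \<eta>) * BL ?Q R"
    using half_space_measure_le(2)[OF Q R(1,2) \<eta>, of "m - \<rho> - \<eta>"] R(3) by simp
  also have "measure ?Q {y \<in> H. ?T y \<le> m - \<rho>} \<le> measure K ({f. \<Psi> f \<le> t} \<union> Bd)"
    unfolding Qeq
  proof (rule K.finite_measure_mono)
    show "{f. ?T (rescale n x (cf f)) \<le> m - \<rho>} \<subseteq> {f. \<Psi> f \<le> t} \<union> Bd"
    proof
      fix f assume "f \<in> {f. ?T (rescale n x (cf f)) \<le> m - \<rho>}"
      then show "f \<in> {f. \<Psi> f \<le> t} \<union> Bd"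
        using key[of f] sgn[of f] by (cases "f \<in> Bd") auto
    qed
  qed auto
  also have "\<dots> \<le> measure K {f. \<Psi> f \<le> t} + measure K Bd"
    by (intro measure_Un_le) auto
  finally show ?thesis
    using upper by linarith
qed

text \<open>The order of the limits matters: \<open>C \<eta>\<close> may be unbounded as \<eta>
  tends to 0, so \<eta> is fixed in terms of the tolerance first and only then n tends to
  infinity.\<close>

lemma tendsto_0_in_prob_dominated:
  fixes Y V B :: "nat \<Rightarrow> 'x \<Rightarrow> real" and \<rho> :: "nat \<Rightarrow> real"
  assumes V: "tendsto_0_in_prob P V" and B: "tendsto_0_in_prob P B" and \<rho>: "\<rho> \<longlonglongrightarrow> 0"
    and le: "\<And>n \<eta>. n \<ge> 1 \<Longrightarrow> 0 < \<eta> \<Longrightarrow> AE x in P n. \<bar>Y n x\<bar> \<le> l * (\<rho> n + \<eta>) + C \<eta> * V n x + B n x"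
  shows "tendsto_0_in_prob P Y"
  unfolding tendsto_0_in_prob_def
proof (intro allI impI)
  fix e :: real assume e: "0 < e"
  \<comment> \<open>The terms with \<open>\<rho> n\<close>, \<eta>, \<open>V\<close> and
    \<open>B\<close> contribute at most e / 5 each, so their sum stays below e. Adding 1 to
    \<open>\<bar>l\<bar>\<close> avoids a division by 0.\<close>
  define \<eta> where "\<eta> = e / (5 * (\<bar>l\<bar> + 1))"
  have \<eta>: "0 < \<eta>" "\<bar>l\<bar> * \<eta> \<le> e / 5"
    using e by (simp_all add: \<eta>_def field_simps add_nonneg_pos)
  define K where "K = \<bar>C \<eta>\<bar> + 1"
  have K: "K > 0" by (simp add: K_def)
  let ?V = "\<lambda>n. {x \<in> space (P n). \<bar>V n x\<bar> > e / (5 * K)}"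
  let ?B = "\<lambda>n. {x \<in> space (P n). \<bar>B n x\<bar> > e / 5}"
  have "(\<lambda>n. outer_measure_of (P n) (?V n) + outer_measure_of (P n) (?B n)) \<longlonglongrightarrow> 0 + 0"
  proof (rule tendsto_add)
    have "0 < e / (5 * K)" "0 < e / 5"
      using e K by simp_all
    with V B show "(\<lambda>n. outer_measure_of (P n) (?V n)) \<longlonglongrightarrow> 0" "(\<lambda>n. outer_measure_of (P n) (?B n)) \<longlonglongrightarrow> 0"
      unfolding tendsto_0_in_prob_def by blast+
  qed
  then have lim: "(\<lambda>n. outer_measure_of (P n) (?V n) + outer_measure_of (P n) (?B n)) \<longlonglongrightarrow> 0"
    by simp
  have "(\<lambda>n. l * \<rho> n) \<longlonglongrightarrow> l * 0"
    by (intro tendsto_intros \<rho>)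
  then have ev: "\<forall>\<^sub>F n in sequentially. l * \<rho> n < e / 5"
    using e by (intro order_tendstoD(2)[of _ "l * 0"]) auto
  have "\<forall>\<^sub>F n in sequentially. outer_measure_of (P n) {x \<in> space (P n). \<bar>Y n x\<bar> > e}
      \<le> outer_measure_of (P n) (?V n) + outer_measure_of (P n) (?B n)"
    using ev eventually_ge_at_top[of 1]
  proof eventually_elim
    case (elim n)
    obtain N where N: "N \<in> null_sets (P n)"
      "{x \<in> space (P n). \<not> \<bar>Y n x\<bar> \<le> l * (\<rho> n + \<eta>) + C \<eta> * V n x + B n x} \<subseteq> N"
      using le[OF elim(2) \<eta>(1)] by (auto elim!: AE_E simp: null_sets_def)
    \<comment> \<open>The exceedance sets need not be measurable. They are replaced by measurable
      hulls of the same outer measure, to which the null set of the almost sure bound can be added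
      at no cost.\<close>
    obtain A where A: "A \<in> sets (P n)" "?V n \<subseteq> A" "outer_measure_of (P n) (?V n) = emeasure (P n) A"
      using outer_measure_of_attain[of "?V n" "P n"] by auto
    obtain A' where A': "A' \<in> sets (P n)" "?B n \<subseteq> A'" "outer_measure_of (P n) (?B n) = emeasure (P n) A'"
      using outer_measure_of_attain[of "?B n" "P n"] by auto
    have "{x \<in> space (P n). \<bar>Y n x\<bar> > e} \<subseteq> (A \<union> A') \<union> N"
    proof
      fix x assume x: "x \<in> {x \<in> space (P n). \<bar>Y n x\<bar> > e}"
      show "x \<in> (A \<union> A') \<union> N"
      proof (rule ccontr)
        assume nx: "x \<notin> (A \<union> A') \<union> N"
        then have y: "\<bar>Y n x\<bar> \<le> l * (\<rho> n + \<eta>) + C \<eta> * V n x + B n x"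
          using N(2) x by auto
        have v: "\<bar>V n x\<bar> \<le> e / (5 * K)" and b: "\<bar>B n x\<bar> \<le> e / 5"
          using nx A(2) A'(2) x by fastforce+
        have "C \<eta> * V n x \<le> \<bar>C \<eta>\<bar> * \<bar>V n x\<bar>"
          using abs_ge_self[of "C \<eta> * V n x"] by (simp add: abs_mult)
        also have "\<dots> \<le> K * (e / (5 * K))"
          unfolding K_def[symmetric] using v K by (intro mult_mono) (auto simp: K_def)
        also have "\<dots> = e / 5"
          using K by simp
        finally have "C \<eta> * V n x \<le> e / 5" .
        moreover have "l * \<eta> \<le> e / 5"
          using \<eta> abs_ge_self[of l] mult_right_mono[of l "\<bar>l\<bar>" \<eta>] by linarith
        ultimately show False
          using y b elim(1) x e by (auto simp: distrib_left)
      qed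
    qed
    then have "outer_measure_of (P n) {x \<in> space (P n). \<bar>Y n x\<bar> > e} \<le> outer_measure_of (P n) ((A \<union> A') \<union> N)"
      by (rule outer_measure_of_mono)
    also have "\<dots> = emeasure (P n) ((A \<union> A') \<union> N)"
      using A A' N by (intro outer_measure_of_eq) auto
    also have "\<dots> = emeasure (P n) (A \<union> A')"
      using A A' N by (intro emeasure_Un_null_set) auto
    also have "\<dots> \<le> emeasure (P n) A + emeasure (P n) A'"
      using A A' by (intro emeasure_subadditive) auto
    finally show ?case using A A' by simp
  qed
  then show "(\<lambda>n. outer_measure_of (P n) {x \<in> space (P n). \<bar>Y n x\<bar> > e}) \<longlonglongrightarrow> 0"
    by (intro tendsto_sandwich[OF _ _ tendsto_const lim]) auto
qed

section \<open>The functional Bernstein--von Mises theorem\<close>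

text \<open>Replacing \<open>h\<close> by \<open>t h\<close> multiplies the left side by t and the
  right side by t squared; divide by t and let t tend to 0. For a linear functional the expansion is
  therefore exact.\<close>

lemma linear_eq_of_quadratic_bound:
  fixes f g :: "'a::real_normed_vector \<Rightarrow> real"
  assumes "linear f" "linear g" and bound: "\<And>h. \<bar>f h - g h\<bar> \<le> C * (norm h)\<^sup>2"
  shows "f h = g h"
proof -
  have le: "\<bar>f h - g h\<bar> \<le> t * (C * (norm h)\<^sup>2)" if "0 < t" for t :: real
  proof -
    have "t * \<bar>f h - g h\<bar> = \<bar>f (t *\<^sub>R h) - g (t *\<^sub>R h)\<bar>"
      using that by (simp add: linear_scale[OF assms(1)] linear_scale[OF assms(2)] abs_mult right_diff_distrib[symmetric])
    also have "\<dots> \<le> t * (t * (C * (norm h)\<^sup>2))"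
      using bound[of "t *\<^sub>R h"] by (simp add: power_mult_distrib power2_eq_square mult_ac)
    finally show ?thesis using that by simp
  qed
  have "((\<lambda>t. t * (C * (norm h)\<^sup>2)) \<longlongrightarrow> 0 * (C * (norm h)\<^sup>2)) (at_right 0)"
    by (intro tendsto_intros)
  moreover have "\<forall>\<^sub>F t in at_right 0. \<bar>f h - g h\<bar> \<le> t * (C * (norm h)\<^sup>2)"
    using le by (auto simp: eventually_at_right_field intro: exI[of _ 1])
  ultimately have "\<bar>f h - g h\<bar> \<le> 0"
    using tendsto_lowerbound[of _ "0 * (C * (norm h)\<^sup>2)" "at_right (0::real)"] by fastforce
  then show ?thesis by simp
qed

theorem theorem4:
  fixes S :: nat and s \<delta> \<alpha> :: real
    and L :: "int set" and Z :: "int \<Rightarrow> int set" and a :: "int \<Rightarrow> real"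
    and \<psi> :: "int \<Rightarrow> int \<Rightarrow> L2"
    and M :: "'w measure" and W :: "'w \<Rightarrow> coeffs"
    and f0 \<Psi>' :: L2 and Prior :: "L2 measure" and post :: "nat \<Rightarrow> coeffs \<Rightarrow> L2 measure"
    and \<Psi> D :: "L2 \<Rightarrow> real"
    and \<mu> \<nu> :: "nat \<Rightarrow> coeffs \<Rightarrow> real"
  defines "P \<equiv> obs_law L Z a \<psi> \<delta> M W"
  assumes basis: "regular_basis S L Z a \<psi>"
    and s: "s > 1/2" "real S > s"
    and \<delta>: "\<delta> > 1/2"
    and W: "white_noise L Z a \<delta> M W"
    and prior: "prob_space Prior" "sets Prior = sets borel"
    and posterior: "\<And>n. n \<ge> 1 \<Longrightarrow> is_posterior (H_borel L Z a \<delta>) (P n) Prior (post n)"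
    and BvM: "weak_BvM L Z a \<psi> \<delta> M W f0 post"
    and \<Psi>_meas: "\<Psi> \<in> borel_measurable borel"
    and expansion: "\<exists>C. \<forall>h. \<bar>\<Psi> (f0 + h) - \<Psi> f0 - D h\<bar> \<le> C * (norm h)\<^sup>2"
    and D: "bounded_linear D"
    and riesz: "\<And>h. D h = inner h \<Psi>'" "\<Psi>' \<noteq> 0" "\<Psi>' \<in> sobolev L Z a \<psi> s"
    and linear_or_rate: "linear \<Psi> \<or>
      (\<exists>r :: nat \<Rightarrow> real. r \<in> o(\<lambda>n. real n powr (- 1/2)) \<and>
         tendsto_0_in_prob (\<lambda>n. P n f0) (\<lambda>n x. measure (post n x) {f. (norm (f - f0))\<^sup>2 > r n}))"
    and \<alpha>: "0 < \<alpha>" "\<alpha> < 1"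
    and \<mu>\<nu>_meas: "\<And>n. n \<ge> 1 \<Longrightarrow> \<mu> n \<in> borel_measurable (H_borel L Z a \<delta>)"
      "\<And>n. n \<ge> 1 \<Longrightarrow> \<nu> n \<in> borel_measurable (H_borel L Z a \<delta>)"
    and quantiles: "\<And>n. n \<ge> 1 \<Longrightarrow> AE x in P n f0.
      measure (distr (post n x) borel \<Psi>) {..\<mu> n x} = \<alpha> / 2 \<and>
      measure (distr (post n x) borel \<Psi>) {\<nu> n x<..} = \<alpha> / 2"
  shows "(\<lambda>n. measure (P n f0) {x \<in> space (P n f0). \<Psi> f0 \<in> {\<mu> n x<..\<nu> n x}})
    \<longlonglongrightarrow> 1 - \<alpha>"
proof -
  interpret noise_space S L Z a \<psi> \<delta>
    using basis \<delta> by unfold_locales auto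
  have df: "dual_form S L Z a \<psi> \<delta> (cf \<Psi>')"
    using s(1) riesz(3) by (rule sobolev_dual_form)
  interpret dual_form S L Z a \<psi> \<delta> "cf \<Psi>'" by fact
  interpret M: prob_space M
    using W by (simp add: white_noise_def)
  have W_meas: "W \<in> measurable M HB"
    and indep: "M.indep_vars (\<lambda>_. borel) (\<lambda>p \<omega>. W \<omega> p) idx"
    and normal: "\<And>p. p \<in> idx \<Longrightarrow> distributed M lborel (\<lambda>\<omega>. W \<omega> p) std_normal_density"
    using W by (auto simp: white_noise_def idx_def)
  have W_H: "W \<omega> \<in> H" if "\<omega> \<in> space M" for \<omega>
    using measurable_space[OF W_meas that] by (simp add: space_HB)
  let ?T = "pairing (cf \<Psi>')"
  define \<sigma> where "\<sigma> = sqrt (\<Sum>\<^sub>\<infinity>p\<in>idx. (cf \<Psi>' p)\<^sup>2)"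
  define N where "N = distr std_normal_distribution borel (\<lambda>x. \<sigma> * x)"
  have \<sigma>: "0 < \<sigma>"
    unfolding \<sigma>_def using infsum_coeffs_of_pos[OF riesz(2)] by simp
  interpret std: real_distribution std_normal_distribution by (rule real_dist_normal_dist)
  interpret N: real_distribution N
    unfolding N_def by (rule std.real_distribution_distr) simp
  have N_cont: "continuous_on UNIV (cdf N)"
    unfolding N_def using \<sigma> by (rule continuous_cdf_scaled_std_normal)
  have N_Lip: "cdf N y - cdf N x \<le> inverse \<sigma> * (y - x)" if "x \<le> y" for x y
    using cdf_scaled_std_normal_Lipschitz[OF \<sigma> that] by (simp add: N_def divide_inverse mult.commute)
  have idx: "countable idx" by simp
  have TW: "distr M borel (\<lambda>\<omega>. ?T (W \<omega>)) = N"
    unfolding pairing_def N_def \<sigma>_def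
    by (rule M.gaussian_series_distr[OF idx indep normal pairing_summable[OF W_H] coeffs_of_sq_summable])
  \<comment> \<open>The limit law is symmetric: negating the coefficients of the series leaves their
    squares unchanged.\<close>
  have TW': "distr M borel (\<lambda>\<omega>. - ?T (W \<omega>)) = N"
  proof -
    have "distr M borel (\<lambda>\<omega>. \<Sum>\<^sub>\<infinity>p\<in>idx. - cf \<Psi>' p * W \<omega> p) =
      distr std_normal_distribution borel (\<lambda>x. sqrt (\<Sum>\<^sub>\<infinity>p\<in>idx. (- cf \<Psi>' p)\<^sup>2) * x)"
      using pairing_summable[OF W_H] coeffs_of_sq_summable
      by (intro M.gaussian_series_distr[OF idx indep normal]) (auto simp: summable_on_uminus)
    then show ?thesis
      by (simp add: pairing_def N_def \<sigma>_def infsum_uminus)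
  qed
  define R where "R = white_noise_law L Z a \<delta> M W"
  have R: "prob_space R" "sets R = sets HB"
    using M.prob_space_distr[OF W_meas] by (simp_all add: R_def white_noise_law_def)
  have R_cdf: "measure R {y \<in> H. ?T y \<le> t} = cdf N t" for t
  proof -
    have h: "{y \<in> H. ?T y \<le> t} \<in> sets HB"
      using borel_measurable_le[OF pairing_measurable, of "\<lambda>_. t"] by (simp add: space_HB)
    have "measure R {y \<in> H. ?T y \<le> t} = measure M (W -` {y \<in> H. ?T y \<le> t} \<inter> space M)"
      unfolding R_def white_noise_law_def by (rule measure_distr[OF W_meas h])
    also have "W -` {y \<in> H. ?T y \<le> t} \<inter> space M = (\<lambda>\<omega>. ?T (W \<omega>)) -` {..t} \<inter> space M"
      using W_H by auto
    also have "measure M \<dots> = measure (distr M borel (\<lambda>\<omega>. ?T (W \<omega>))) {..t}"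
      by (intro measure_distr[symmetric] measurable_compose[OF W_meas pairing_measurable]) simp
    finally show ?thesis
      by (simp add: TW cdf_def)
  qed
  define X where "X n \<omega> = (\<lambda>p. cf f0 p + W \<omega> p / sqrt (real n))" for n \<omega>
  have X_meas: "X n \<in> measurable M HB" for n
    using measurable_compose[OF W_meas affine_measurable_HB[OF coeffs_of_in_H, of f0 "1 / sqrt (real n)"]]
    by (simp add: X_def[abs_def])
  have P_eq: "P n f0 = distr M HB (X n)" for n
    unfolding P_def obs_law_def X_def ..
  \<comment> \<open>This includes n = 0, where division by \<open>sqrt 0\<close> yields 0 and the
    observation is constantly \<open>cf f0\<close>.\<close>
  have P_prob: "prob_space (P n f0)" for n
    unfolding P_eq by (rule M.prob_space_distr[OF X_meas])
  have P_space: "space (P n f0) = H" and P_sets: "sets (P n f0) = sets HB" for n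
    by (simp_all add: P_eq space_HB)
  \<comment> \<open>Up to sign, the pairing with the noise recovered from the observation. At
    \<open>X n\<close> that noise is \<open>W\<close> itself for every n \<ge> 1, so the law of
    \<open>G n\<close> does not depend on n.\<close>
  define G where "G n x = - ?T (\<lambda>p. sqrt (real n) * (x p - cf f0 p))" for n x
  have G_meas: "G n \<in> borel_measurable HB" for n
  proof -
    have "(\<lambda>x p. - sqrt n * cf f0 p + sqrt n * x p) \<in> measurable HB HB"
      by (intro affine_measurable_HB H_scale coeffs_of_in_H)
    from measurable_compose[OF this pairing_measurable]
    have "(\<lambda>x. ?T (\<lambda>p. sqrt (real n) * (x p - cf f0 p))) \<in> borel_measurable HB"
      by (simp add: algebra_simps)
    then show ?thesis
      unfolding G_def by (rule borel_measurable_uminus)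
  qed
  have G_law: "distr (P n f0) borel (G n) = N" if "n \<ge> 1" for n
  proof -
    have "distr (P n f0) borel (G n) = distr M borel (\<lambda>\<omega>. G n (X n \<omega>))"
      unfolding P_eq by (subst distr_distr[OF G_meas X_meas]) (simp add: o_def)
    also have "(\<lambda>\<omega>. G n (X n \<omega>)) = (\<lambda>\<omega>. - ?T (W \<omega>))"
      using that by (simp add: G_def X_def)
    finally show ?thesis by (simp add: TW')
  qed
  \<comment> \<open>Both alternatives take one form: off \<open>Bd n\<close> the scaled
    linearisation error is at most \<open>\<rho> n\<close>, and the posterior mass of
    \<open>Bd n\<close> vanishes in probability. In the linear case the set is empty and the error
    0; otherwise the set is the complement of the contraction ball.\<close>
  obtain Bd \<rho> where Bd_sets: "\<And>n. Bd n \<in> sets borel" and \<rho>_lim: "\<rho> \<longlonglongrightarrow> 0" and \<rho>_nonneg: "\<And>n. 0 \<le> \<rho> n"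
    and Bd_lim: "tendsto_0_in_prob (\<lambda>n. P n f0) (\<lambda>n x. measure (post n x) (Bd n))"
    and lin: "\<And>n f. f \<notin> Bd n \<Longrightarrow> sqrt (real n) * \<bar>\<Psi> f - \<Psi> f0 - inner (f - f0) \<Psi>'\<bar> \<le> \<rho> n"
  proof -
    obtain C where C: "\<And>h. \<bar>\<Psi> (f0 + h) - \<Psi> f0 - D h\<bar> \<le> C * (norm h)\<^sup>2"
      using expansion by blast
    have C': "\<bar>\<Psi> f - \<Psi> f0 - inner (f - f0) \<Psi>'\<bar> \<le> \<bar>C\<bar> * (norm (f - f0))\<^sup>2" for f
      using C[of "f - f0"] mult_right_mono[OF abs_ge_self[of C], of "(norm (f - f0))\<^sup>2"] riesz(1)[of "f - f0"]
      by simp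
    from linear_or_rate show thesis
    proof
      assume "linear \<Psi>"
      then have "\<bar>\<Psi> h - D h\<bar> \<le> C * (norm h)\<^sup>2" for h
        using C[of h] by (simp add: linear_add)
      then have "\<Psi> h = D h" for h
        by (rule linear_eq_of_quadratic_bound[OF \<open>linear \<Psi>\<close> bounded_linear.linear[OF D]])
      then have "\<Psi> f - \<Psi> f0 = inner (f - f0) \<Psi>'" for f
        using riesz(1) linear_diff[OF \<open>linear \<Psi>\<close>, of f f0] by simp
      then show thesis
        by (intro that[of "\<lambda>_. {}" "\<lambda>_. 0"]) (auto simp: tendsto_0_in_prob_def outer_measure_of_eq)
    next
      assume "\<exists>r :: nat \<Rightarrow> real. r \<in> o(\<lambda>n. real n powr (- 1/2)) \<and>
         tendsto_0_in_prob (\<lambda>n. P n f0) (\<lambda>n x. measure (post n x) {f. (norm (f - f0))\<^sup>2 > r n})"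
      then obtain r :: "nat \<Rightarrow> real" where r: "r \<in> o(\<lambda>n. real n powr (- 1/2))"
        "tendsto_0_in_prob (\<lambda>n. P n f0) (\<lambda>n x. measure (post n x) {f. (norm (f - f0))\<^sup>2 > r n})"
        by blast
      show thesis
      \<comment> \<open>On the ball the remainder is at most a constant times \<open>r n\<close>,
        and the rate says that \<open>sqrt (real n) * r n\<close> tends to 0. The absolute values
        are there because neither \<open>C\<close> nor \<open>r n\<close> has a known sign.\<close>
      proof (rule that[of "\<lambda>n. {f. (norm (f - f0))\<^sup>2 > r n}" "\<lambda>n. \<bar>C\<bar> * (sqrt (real n) * \<bar>r n\<bar>)"])
        show "{f. (norm (f - f0))\<^sup>2 > r n} \<in> sets borel" for n
          by (intro borel_open open_Collect_less continuous_intros)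
        have "(\<lambda>n. r n / real n powr (- 1/2)) \<longlonglongrightarrow> 0"
          using r(1) by (rule smalloD_tendsto)
        then have "(\<lambda>n. \<bar>C\<bar> * \<bar>r n / real n powr (- 1/2)\<bar>) \<longlonglongrightarrow> \<bar>C\<bar> * \<bar>0\<bar>"
          by (intro tendsto_intros)
        moreover have "\<forall>\<^sub>F n in sequentially. \<bar>C\<bar> * \<bar>r n / real n powr (- 1/2)\<bar> = \<bar>C\<bar> * (sqrt (real n) * \<bar>r n\<bar>)"
          using eventually_ge_at_top[of 1]
          by eventually_elim (simp add: powr_minus powr_half_sqrt abs_mult field_simps)
        ultimately show "(\<lambda>n. \<bar>C\<bar> * (sqrt (real n) * \<bar>r n\<bar>)) \<longlonglongrightarrow> 0"
          by (auto intro: Lim_transform_eventually)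
        fix n and f assume "f \<notin> {f. (norm (f - f0))\<^sup>2 > r n}"
        then have "\<bar>C\<bar> * (norm (f - f0))\<^sup>2 \<le> \<bar>C\<bar> * \<bar>r n\<bar>"
          by (intro mult_left_mono) auto
        then have "sqrt (real n) * \<bar>\<Psi> f - \<Psi> f0 - inner (f - f0) \<Psi>'\<bar> \<le> sqrt (real n) * (\<bar>C\<bar> * \<bar>r n\<bar>)"
          using C'[of f] by (intro mult_left_mono) auto
        then show "sqrt (real n) * \<bar>\<Psi> f - \<Psi> f0 - inner (f - f0) \<Psi>'\<bar> \<le> \<bar>C\<bar> * (sqrt (real n) * \<bar>r n\<bar>)"
          by (simp add: mult_ac)
      qed (use r(2) in auto)
    qed
  qed
  have post: "prob_space (post n x)" "sets (post n x) = sets borel" if "n \<ge> 1" "x \<in> H" for n x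
  proof -
    have "post n x \<in> space (prob_algebra borel)"
      using posterior[OF that(1)] that(2) by (auto simp: is_posterior_def space_HB dest: measurable_space)
    then show "prob_space (post n x)" "sets (post n x) = sets borel"
      by (auto simp: space_prob_algebra)
  qed
  \<comment> \<open>Stated for an arbitrary data-dependent threshold with posterior level
    \<open>q\<close>, since it serves both endpoints: \<mu> with \<alpha> / 2 and \<nu> with 1 -
    \<alpha> / 2.\<close>
  have conv: "tendsto_0_in_prob (\<lambda>n. P n f0) (\<lambda>n x. cdf N (sqrt (real n) * (t n x - \<Psi> f0) + G n x) - q)"
    if q: "\<And>n. n \<ge> 1 \<Longrightarrow> AE x in P n f0. measure (post n x) {f. \<Psi> f \<le> t n x} = q"
    for t :: "nat \<Rightarrow> coeffs \<Rightarrow> real" and q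
  proof (rule tendsto_0_in_prob_dominated[OF BvM[unfolded weak_BvM_def, folded P_def] Bd_lim \<rho>_lim])
    fix n :: nat and \<eta> :: real assume n: "n \<ge> 1" and \<eta>: "0 < \<eta>"
    show "AE x in P n f0. \<bar>cdf N (sqrt (real n) * (t n x - \<Psi> f0) + G n x) - q\<bar> \<le> inverse \<sigma> * (\<rho> n + \<eta>) +
        (1 + dnorm / \<eta>) * BL (distr (post n x) HB (\<lambda>f. rescale n x (cf f))) (white_noise_law L Z a \<delta> M W) +
        measure (post n x) (Bd n)"
      using q[OF n] AE_space
    proof eventually_elim
      case (elim x)
      then have x: "x \<in> H" by (simp add: P_space)
      show ?case
        using posterior_quantile_bound[OF df post[OF n x] x n \<Psi>_meas Bd_sets lin R R_cdf N_Lip \<eta> \<rho>_nonneg, where t = "t n x"]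
          elim(1) by (simp add: G_def R_def)
    qed
  qed
  have distr_le: "measure (distr (post n x) borel \<Psi>) A = measure (post n x) (\<Psi> -` A)"
    if "n \<ge> 1" "x \<in> H" "A \<in> sets borel" for n x A
  proof -
    have "\<Psi> \<in> borel_measurable (post n x)"
      using \<Psi>_meas post(2)[OF that(1,2)] measurable_cong_sets by blast
    moreover have "space (post n x) = UNIV"
      using sets_eq_imp_space_eq[OF post(2)[OF that(1,2)]] by simp
    ultimately show ?thesis
      using that(3) by (simp add: measure_distr)
  qed
  have lower: "AE x in P n f0. measure (post n x) {f. \<Psi> f \<le> \<mu> n x} = \<alpha> / 2" if "n \<ge> 1" for n
    using quantiles[OF that] AE_space
    by eventually_elim (use distr_le[OF that] in \<open>auto simp: P_space vimage_def\<close>)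
  have upper: "AE x in P n f0. measure (post n x) {f. \<Psi> f \<le> \<nu> n x} = 1 - \<alpha> / 2" if "n \<ge> 1" for n
    using quantiles[OF that] AE_space
  proof eventually_elim
    case (elim x)
    then have x: "x \<in> H" by (simp add: P_space)
    interpret post: prob_space "post n x" by (rule post[OF that x])
    have sp: "space (post n x) = UNIV"
      using sets_eq_imp_space_eq[OF post(2)[OF that x]] by simp
    have "{f. \<Psi> f \<le> \<nu> n x} \<in> sets (post n x)"
      using \<Psi>_meas by (simp add: post(2)[OF that x])
    from post.prob_compl[OF this] have "1 - post.prob {f. \<Psi> f \<le> \<nu> n x} = post.prob (\<Psi> -` {\<nu> n x<..})"
      by (simp add: sp vimage_def Compl_eq_Diff_UNIV[symmetric] Collect_neg_eq[symmetric] not_le)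
    then show ?case
      using elim(1) distr_le[OF that x, of "{\<nu> n x<..}"] by simp
  qed
  let ?lev = "\<lambda>t n x. sqrt (real n) * (t n x - \<Psi> f0) + G n x :: real"
  have meas: "?lev t n \<in> borel_measurable (P n f0)" if "t n \<in> borel_measurable HB" for t n
    unfolding measurable_cong_sets[OF P_sets refl]
    by (intro borel_measurable_add borel_measurable_times borel_measurable_diff that G_meas) auto
  have "(\<lambda>n. measure (P n f0) {x \<in> space (P n f0). ?lev \<mu> n x < G n x \<and> G n x \<le> ?lev \<nu> n x})
      \<longlonglongrightarrow> (1 - \<alpha> / 2) - \<alpha> / 2"
  proof (rule interval_coverage[OF N.real_distribution_axioms N_cont P_prob])
    show "G n \<in> borel_measurable (P n f0)" for n
      using G_meas measurable_cong_sets[OF P_sets refl] by blast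
    show "distr (P n f0) borel (G n) = N" if "n \<ge> 1" for n
      using that by (rule G_law)
    show "?lev \<mu> n \<in> borel_measurable (P n f0)" "?lev \<nu> n \<in> borel_measurable (P n f0)" if "n \<ge> 1" for n
      by (rule meas[of \<mu> n, OF \<mu>\<nu>_meas(1)[OF that]]) (rule meas[of \<nu> n, OF \<mu>\<nu>_meas(2)[OF that]])
    show "tendsto_0_in_prob (\<lambda>n. P n f0) (\<lambda>n x. cdf N (?lev \<mu> n x) - \<alpha> / 2)"
      using lower by (rule conv)
    show "tendsto_0_in_prob (\<lambda>n. P n f0) (\<lambda>n x. cdf N (?lev \<nu> n x) - (1 - \<alpha> / 2))"
      using upper by (rule conv)
  qed (use \<alpha> in auto)
  \<comment> \<open>After \<open>G n\<close> cancels, the conditions concern only the signs of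
    \<open>\<mu> n x - \<Psi> f0\<close> and \<open>\<nu> n x - \<Psi> f0\<close> times
    \<open>sqrt (real n)\<close>, a positive factor once n \<ge> 1.\<close>
  moreover have "\<forall>\<^sub>F n in sequentially.
      measure (P n f0) {x \<in> space (P n f0). ?lev \<mu> n x < G n x \<and> G n x \<le> ?lev \<nu> n x} =
      measure (P n f0) {x \<in> space (P n f0). \<Psi> f0 \<in> {\<mu> n x<..\<nu> n x}}"
    using eventually_ge_at_top[of 1]
    by eventually_elim (simp add: mult_less_0_iff zero_le_mult_iff)
  ultimately show ?thesis
    by (auto intro: Lim_transform_eventually)
qed

end
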